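(* Let $\gamma \in \mathbb{R}$ and let $h\colon \mathbb{R}\to\mathbb{R}$ be a (Borel measurable) function with $\int h(x)^2 \,\mathrm{d}G_\gamma(x) < \infty$. Then $$\sigma^2_{\mathrm{sb}}(h) \le \sigma^2_{\mathrm{db}}(h).$$ Moreover, if $\sigma^2_{\mathrm{db}}(h)>0$ (so that the correlations below are defined), equality holds if and only if $$\mathrm{Corr}\big(h(Y_{1,\zeta}), h(Y_{2,\zeta})\big) = R(G_{\zeta,\gamma}) = 1-\zeta$$ for Lebesgue almost every $\zeta \in [0,1]$.
   Context: $G_\gamma$ is the generalized extreme value distribution with extreme value index $\gamma\in\mathbb{R}$, with cdf $G_\gamma(x) = \exp\{-(1+\gamma x)^{-1/\gamma}\}$ for $x$ with $1+\gamma x>0$ (interpreted as $\exp(-e^{-x})$ if $\gamma=0$; for $1+\gamma x\le 0$, $G_\gamma(x)=0$ if $\gamma>0$ and $G_\gamma(x)=1$ if $\gamma<0$). For $\phi,\psi\in[0,1]$, the Marshall–Olkin copula is $C_{\phi,\psi}(u,v)=\min(u^{1-\phi}v,\,uv^{1-\psi})$, $u,v\in[0,1]$. For $\zeta\in[0,1]$, $G_{\zeta,\gamma}$ is the bivariate cdf $G_{\zeta,\gamma}(x,y) = C_{1-\zeta,1-\zeta}\{G_\gamma(x),G_\gamma(y)\}$, $x,y\in\mathbb{R}$, and $(Y_{1,\zeta},Y_{2,\zeta})$ denotes a random vector with cdf $G_{\zeta,\gamma}$ (in particular both margins have cdf $G_\gamma$). For $h$ square-integrable with respect to $G_\gamma$,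 the sliding and disjoint block maxima asymptotic variances are $$\sigma^2_{\mathrm{sb}}(h) := 2\int_0^1 \mathrm{Cov}\big(h(Y_{1,\zeta}),h(Y_{2,\zeta})\big)\,\mathrm{d}\zeta, \qquad \sigma^2_{\mathrm{db}}(h) := \mathrm{Var}(h(Y_1)),\quad Y_1\sim G_\gamma.$$ For a bivariate cdf $H$ and $(X_1,X_2)$ with cdf $H$, the maximal correlation coefficient is $R(H):=\sup_{f,g}\mathrm{Corr}(f(X_1),g(X_2))$, where the supremum is over all (Borel measurable) functions $f,g:\mathbb{R}\to\mathbb{R}$ such that $\mathrm{Var}(f(X_1)),\mathrm{Var}(g(X_2))$ exist and lie in $(0,\infty)$, and $\mathrm{Corr}$ is the Pearson correlation. *)

theory Defs
  imports "HOL-Probability.Probability" "HOL-Real_Asymp.Real_Asymp"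
begin

definition gev_cdf :: "real \<Rightarrow> real \<Rightarrow> real" where
  "gev_cdf \<gamma> x =
     (if \<gamma> = 0 then exp (- exp (- x))
      else if 1 + \<gamma> * x > 0 then exp (- ((1 + \<gamma> * x) powr (- 1 / \<gamma>)))
      else if \<gamma> > 0 then 0 else 1)"

definition gev :: "real \<Rightarrow> real measure" where
  "gev \<gamma> = interval_measure (gev_cdf \<gamma>)"

(* In Isabelle 0 powr 0 = 0 rather than 1. On [0,1] x [0,1] this does not change
   the minimum below: if u = 0 then the second term is already 0 and the first is
   nonnegative, and symmetrically for v = 0. *)
definition marshall_olkin :: "real \<Rightarrow> real \<Rightarrow> real \<Rightarrow> real \<Rightarrow> real" where
  "marshall_olkin \<phi> \<psi> u v = min (u powr (1 - \<phi>) * v) (u * v powr (1 - \<psi>))"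

definition biv_gev_cdf :: "real \<Rightarrow> real \<Rightarrow> real \<Rightarrow> real \<Rightarrow> real" where
  "biv_gev_cdf \<zeta> \<gamma> x y = marshall_olkin (1 - \<zeta>) (1 - \<zeta>) (gev_cdf \<gamma> x) (gev_cdf \<gamma> y)"

definition has_biv_cdf :: "(real \<times> real) measure \<Rightarrow> (real \<Rightarrow> real \<Rightarrow> real) \<Rightarrow> bool" where
  "has_biv_cdf M H \<longleftrightarrow>
     prob_space M \<and> sets M = sets borel \<and> (\<forall>x y. measure M ({..x} \<times> {..y}) = H x y)"

(* The law of a random vector with cdf H; the vector itself is realised by the
   coordinate maps fst and snd. A law with cdf H is unique by has_biv_cdf_unique,
   and for the cdfs biv_gev_cdf it exists by has_biv_cdf_biv_gev. *)
definition biv_law :: "(real \<Rightarrow> real \<Rightarrow> real) \<Rightarrow> (real \<times> real) measure" where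
  "biv_law H = (THE M. has_biv_cdf M H)"

definition has_variance :: "'a measure \<Rightarrow> ('a \<Rightarrow> real) \<Rightarrow> bool" where
  "has_variance M X \<longleftrightarrow>
     integrable M X \<and> integrable M (\<lambda>\<omega>. (X \<omega> - integral\<^sup>L M X)\<^sup>2)"

definition var :: "'a measure \<Rightarrow> ('a \<Rightarrow> real) \<Rightarrow> real" where
  "var M X = (\<integral>\<omega>. (X \<omega> - integral\<^sup>L M X)\<^sup>2 \<partial>M)"

definition cov :: "'a measure \<Rightarrow> ('a \<Rightarrow> real) \<Rightarrow> ('a \<Rightarrow> real) \<Rightarrow> real" where
  "cov M X Y = (\<integral>\<omega>. (X \<omega> - integral\<^sup>L M X) * (Y \<omega> - integral\<^sup>L M Y) \<partial>M)"

definition corr :: "'a measure \<Rightarrow> ('a \<Rightarrow> real) \<Rightarrow> ('a \<Rightarrow> real) \<Rightarrow> real" where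
  "corr M X Y = cov M X Y / (sqrt (var M X) * sqrt (var M Y))"

(* A real supremum: the set is bounded above by 1, and it is nonempty as soon as
   both margins of H are nondegenerate. *)
definition max_corr :: "(real \<Rightarrow> real \<Rightarrow> real) \<Rightarrow> real" where
  "max_corr H = Sup {corr (biv_law H) (\<lambda>p. f (fst p)) (\<lambda>p. g (snd p)) | f g.
     f \<in> borel_measurable borel \<and> g \<in> borel_measurable borel \<and>
     has_variance (biv_law H) (\<lambda>p. f (fst p)) \<and> 0 < var (biv_law H) (\<lambda>p. f (fst p)) \<and>
     has_variance (biv_law H) (\<lambda>p. g (snd p)) \<and> 0 < var (biv_law H) (\<lambda>p. g (snd p))}"

definition sigma2_sb :: "real \<Rightarrow> (real \<Rightarrow> real) \<Rightarrow> real" where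
  "sigma2_sb \<gamma> h =
     2 * (LINT \<zeta>:{0..1}|lborel.
            cov (biv_law (biv_gev_cdf \<zeta> \<gamma>)) (\<lambda>p. h (fst p)) (\<lambda>p. h (snd p)))"

definition sigma2_db :: "real \<Rightarrow> (real \<Rightarrow> real) \<Rightarrow> real" where
  "sigma2_db \<gamma> h = var (gev \<gamma>) h"


section \<open>The objects above are well defined\<close>

lemma has_biv_cdf_unique:
  assumes "has_biv_cdf M H" "has_biv_cdf N H"
  shows "M = N"
proof -
  interpret M: prob_space M using assms by (simp add: has_biv_cdf_def)
  interpret N: prob_space N using assms by (simp add: has_biv_cdf_def)
  have setsM: "sets M = sets borel" and setsN: "sets N = sets borel"
    using assms by (auto simp: has_biv_cdf_def)
  have borel: "sets (borel :: (real \<times> real) measure) = sigma_sets UNIV (range (\<lambda>a. {..a}))"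
    by (subst borel_eq_atMost) simp
  have Iic: "{..a} = {..fst a} \<times> {..snd a}" for a :: "real \<times> real"
    by (auto simp: less_eq_prod_def)
  have eq: "emeasure M {..a} = emeasure N {..a}" for a
    using assms unfolding Iic has_biv_cdf_def
    by (simp add: M.emeasure_eq_measure N.emeasure_eq_measure)
  show ?thesis
  proof (rule measure_eqI_generator_eq[where E = "range (\<lambda>a. {..a})" and \<Omega> = UNIV
        and A = "\<lambda>n. {..(real n, real n)}"])
    show "Int_stable (range (\<lambda>a::real \<times> real. {..a}))"
    proof (rule Int_stableI)
      fix A B assume "A \<in> range (\<lambda>a::real \<times> real. {..a})" "B \<in> range (\<lambda>a::real \<times> real. {..a})"
      then obtain a b where "A = {..a}" "B = {..b}" by auto
      then have "A \<inter> B = {..inf a b}" by auto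
      then show "A \<inter> B \<in> range (\<lambda>a::real \<times> real. {..a})" by blast
    qed
    show "(\<Union>n. {..(real n, real n)}) = (UNIV :: (real \<times> real) set)"
    proof (intro set_eqI iffI UNIV_I)
      fix p :: "real \<times> real"
      obtain n where "max (fst p) (snd p) \<le> real n" using real_arch_simple by blast
      then show "p \<in> (\<Union>n. {..(real n, real n)})" by (auto simp: less_eq_prod_def)
    qed
  qed (use eq setsM setsN borel in auto)
qed

lemma biv_law_eqI: "has_biv_cdf M H \<Longrightarrow> biv_law H = M"
  unfolding biv_law_def by (rule the_equality) (auto intro: has_biv_cdf_unique)

lemma gev_cdf_nonneg: "0 \<le> gev_cdf \<gamma> x" and gev_cdf_le_1: "gev_cdf \<gamma> x \<le> 1"
  by (auto simp: gev_cdf_def)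

lemma gev_cdf_mono:
  assumes "x \<le> y" shows "gev_cdf \<gamma> x \<le> gev_cdf \<gamma> y"
proof -
  consider "\<gamma> = 0" | "\<gamma> > 0" | "\<gamma> < 0" by linarith
  then show ?thesis
  proof cases
    case 1
    then show ?thesis using assms by (simp add: gev_cdf_def)
  next
    case 2
    then have le: "1 + \<gamma> * x \<le> 1 + \<gamma> * y" using assms by simp
    show ?thesis
    proof (cases "1 + \<gamma> * x > 0")
      case True
      then have "(1 + \<gamma> * y) powr (- 1 / \<gamma>) \<le> (1 + \<gamma> * x) powr (- 1 / \<gamma>)"
        using 2 le by (intro powr_mono2') auto
      moreover have "1 + \<gamma> * y > 0" using True le by linarith
      ultimately show ?thesis using True 2 by (simp add: gev_cdf_def)
    next
      case False
      then show ?thesis using 2 by (simp add: gev_cdf_def)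
    qed
  next
    case 3
    then have le: "1 + \<gamma> * y \<le> 1 + \<gamma> * x" using assms by (simp add: mult_left_mono_neg)
    show ?thesis
    proof (cases "1 + \<gamma> * y > 0")
      case True
      have "- 1 / \<gamma> \<ge> 0" using 3 by (simp add: divide_simps)
      then have "(1 + \<gamma> * y) powr (- 1 / \<gamma>) \<le> (1 + \<gamma> * x) powr (- 1 / \<gamma>)"
        using True le by (intro powr_mono2) auto
      moreover have "1 + \<gamma> * x > 0" using True le by linarith
      ultimately show ?thesis using True 3 by (simp add: gev_cdf_def)
    next
      case False
      then show ?thesis using 3 by (simp add: gev_cdf_def)
    qed
  qed
qed

lemma gev_cdf_neg:
  "\<gamma> < 0 \<Longrightarrow> gev_cdf \<gamma> x = exp (- (max 0 (1 + \<gamma> * x) powr (- 1 / \<gamma>)))"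
  by (auto simp: gev_cdf_def max_def)

lemma gev_cdf_right_cont: "continuous (at_right a) (gev_cdf \<gamma>)"
proof -
  consider "\<gamma> = 0" | "\<gamma> > 0" | "\<gamma> < 0" by linarith
  then show ?thesis
  proof cases
    case 1
    have "gev_cdf \<gamma> = (\<lambda>x. exp (- exp (- x)))" using 1 by (auto simp: gev_cdf_def)
    then show ?thesis by (auto intro!: continuous_intros)
  next
    case 3
    have pos: "- 1 / \<gamma> > 0" using 3 by (simp add: divide_simps)
    have "((\<lambda>x. max 0 (1 + \<gamma> * x) powr (- 1 / \<gamma>))
        \<longlongrightarrow> max 0 (1 + \<gamma> * a) powr (- 1 / \<gamma>)) (at_right a)"
      by (intro tendsto_powr' tendsto_intros disjI2 conjI pos) auto
    then show ?thesis
      unfolding continuous_within gev_cdf_neg[OF 3] by (intro tendsto_exp tendsto_minus)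
  next
    case 2
    consider (inside) "1 + \<gamma> * a > 0" | (edge) "1 + \<gamma> * a = 0" | (outside) "1 + \<gamma> * a < 0" by linarith
    then show ?thesis
    proof cases
      case inside
      have "eventually (\<lambda>x. x > a) (at_right a)" by (simp add: eventually_at_right_less)
      then have ev: "eventually (\<lambda>x. exp (- ((1 + \<gamma> * x) powr (- 1 / \<gamma>))) = gev_cdf \<gamma> x) (at_right a)"
      proof eventually_elim
        case (elim x)
        then have "1 + \<gamma> * x > 0" using inside 2 mult_strict_left_mono[OF elim 2] by linarith
        then show ?case using 2 by (simp add: gev_cdf_def)
      qed
      have "((\<lambda>x. exp (- ((1 + \<gamma> * x) powr (- 1 / \<gamma>)))) \<longlongrightarrow> gev_cdf \<gamma> a) (at_right a)"
        using inside 2 by (auto simp: gev_cdf_def intro!: tendsto_eq_intros)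
      then show ?thesis
        unfolding continuous_within by (rule Lim_transform_eventually[OF _ ev])
    next
      case edge
      have "eventually (\<lambda>x. x > a) (at_right a)" by (simp add: eventually_at_right_less)
      then have pos: "eventually (\<lambda>x. 1 + \<gamma> * x > 0) (at_right a)"
      proof eventually_elim
        case (elim x)
        then show ?case using edge mult_strict_left_mono[OF elim 2] by linarith
      qed
      then have ev: "eventually (\<lambda>x. exp (- ((1 + \<gamma> * x) powr (- 1 / \<gamma>))) = gev_cdf \<gamma> x) (at_right a)"
        by eventually_elim (use 2 in \<open>simp add: gev_cdf_def\<close>)
      have "((\<lambda>x. 1 + \<gamma> * x) \<longlongrightarrow> 0) (at_right a)"
        using edge by (auto intro!: tendsto_eq_intros)
      then have "filterlim (\<lambda>x. 1 + \<gamma> * x) (at_right 0) (at_right a)"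
        using pos by (auto simp: filterlim_at elim: eventually_mono)
      moreover have "filterlim (\<lambda>y::real. y powr (- 1 / \<gamma>)) at_top (at_right 0)"
        using 2 by real_asymp
      ultimately have "filterlim (\<lambda>x. (1 + \<gamma> * x) powr (- 1 / \<gamma>)) at_top (at_right a)"
        using filterlim_compose by blast
      then have "((\<lambda>x. exp (- ((1 + \<gamma> * x) powr (- 1 / \<gamma>)))) \<longlongrightarrow> 0) (at_right a)"
        by (intro filterlim_compose[OF exp_at_bot] filterlim_compose[OF filterlim_uminus_at_bot_at_top])
      moreover have "gev_cdf \<gamma> a = 0" using edge 2 by (simp add: gev_cdf_def)
      ultimately show ?thesis
        unfolding continuous_within by (auto intro: Lim_transform_eventually[OF _ ev])
    next
      case outside
      have "eventually (\<lambda>x. 1 + \<gamma> * x < 0) (at_right a)"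
        by (rule order_tendstoD(2)[of _ "1 + \<gamma> * a"]) (auto intro!: tendsto_intros outside)
      then have "eventually (\<lambda>x. 0 = gev_cdf \<gamma> x) (at_right a)"
        by eventually_elim (use 2 in \<open>simp add: gev_cdf_def\<close>)
      moreover have "gev_cdf \<gamma> a = 0" using outside 2 by (simp add: gev_cdf_def)
      ultimately show ?thesis
        unfolding continuous_within by (auto intro: Lim_transform_eventually[OF tendsto_const])
    qed
  qed
qed

lemma gev_cdf_at_bot: "(gev_cdf \<gamma> \<longlongrightarrow> 0) at_bot"
proof -
  consider "\<gamma> = 0" | "\<gamma> > 0" | "\<gamma> < 0" by linarith
  then show ?thesis
  proof cases
    case 1
    have "gev_cdf \<gamma> = (\<lambda>x. exp (- exp (- x)))" using 1 by (auto simp: gev_cdf_def)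
    moreover have "((\<lambda>x::real. exp (- exp (- x))) \<longlongrightarrow> 0) at_bot" by real_asymp
    ultimately show ?thesis by simp
  next
    case 2
    have "eventually (\<lambda>x. 1 + \<gamma> * x < 0) at_bot" using 2 by real_asymp
    then have "eventually (\<lambda>x. 0 = gev_cdf \<gamma> x) at_bot"
      by eventually_elim (use 2 in \<open>simp add: gev_cdf_def\<close>)
    then show ?thesis by (rule Lim_transform_eventually[OF tendsto_const])
  next
    case 3
    have "eventually (\<lambda>x. 1 + \<gamma> * x > 0) at_bot" using 3 by real_asymp
    then have "eventually (\<lambda>x. exp (- ((1 + \<gamma> * x) powr (- 1 / \<gamma>))) = gev_cdf \<gamma> x) at_bot"
      by eventually_elim (use 3 in \<open>simp add: gev_cdf_def\<close>)
    moreover have "((\<lambda>x. exp (- ((1 + \<gamma> * x) powr (- 1 / \<gamma>)))) \<longlongrightarrow> 0) at_bot"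
    proof -
      have *: "- 1 / \<gamma> > 0" using 3 by (simp add: divide_simps)
      have "filterlim (\<lambda>x. 1 + \<gamma> * x) at_top at_bot" using 3 by real_asymp
      moreover have "filterlim (\<lambda>y::real. y powr (- 1 / \<gamma>)) at_top at_top"
        using * by real_asymp
      ultimately have "filterlim (\<lambda>x. (1 + \<gamma> * x) powr (- 1 / \<gamma>)) at_top at_bot"
        using filterlim_compose by blast
      then show ?thesis
        by (intro filterlim_compose[OF exp_at_bot] filterlim_compose[OF filterlim_uminus_at_bot_at_top])
    qed
    ultimately show ?thesis using Lim_transform_eventually by blast
  qed
qed

lemma gev_cdf_at_top: "(gev_cdf \<gamma> \<longlongrightarrow> 1) at_top"
proof -
  consider "\<gamma> = 0" | "\<gamma> > 0" | "\<gamma> < 0" by linarith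
  then show ?thesis
  proof cases
    case 1
    have "gev_cdf \<gamma> = (\<lambda>x. exp (- exp (- x)))" using 1 by (auto simp: gev_cdf_def)
    moreover have "((\<lambda>x::real. exp (- exp (- x))) \<longlongrightarrow> 1) at_top" by real_asymp
    ultimately show ?thesis by simp
  next
    case 3
    have "eventually (\<lambda>x. 1 + \<gamma> * x < 0) at_top" using 3 by real_asymp
    then have "eventually (\<lambda>x. 1 = gev_cdf \<gamma> x) at_top"
      by eventually_elim (use 3 in \<open>simp add: gev_cdf_def\<close>)
    then show ?thesis by (rule Lim_transform_eventually[OF tendsto_const])
  next
    case 2
    have "eventually (\<lambda>x. 1 + \<gamma> * x > 0) at_top" using 2 by real_asymp
    then have "eventually (\<lambda>x. exp (- ((1 + \<gamma> * x) powr (- 1 / \<gamma>))) = gev_cdf \<gamma> x) at_top"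
      by eventually_elim (use 2 in \<open>simp add: gev_cdf_def\<close>)
    moreover have "((\<lambda>x. exp (- ((1 + \<gamma> * x) powr (- 1 / \<gamma>)))) \<longlongrightarrow> exp (- 0)) at_top"
    proof -
      have *: "- 1 / \<gamma> < 0" using 2 by (simp add: divide_simps)
      have "filterlim (\<lambda>x. 1 + \<gamma> * x) at_top at_top" using 2 by real_asymp
      then have "((\<lambda>x. (1 + \<gamma> * x) powr (- 1 / \<gamma>)) \<longlongrightarrow> 0) at_top"
        using tendsto_neg_powr[OF *] by blast
      then show ?thesis by (intro tendsto_intros)
    qed
    ultimately show ?thesis using Lim_transform_eventually by fastforce
  qed
qed

lemma real_distribution_gev: "real_distribution (gev \<gamma>)"
  and cdf_gev: "cdf (gev \<gamma>) = gev_cdf \<gamma>"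
  unfolding gev_def
  by (rule real_distribution_interval_measure cdf_interval_measure;
      rule gev_cdf_mono gev_cdf_right_cont gev_cdf_at_bot gev_cdf_at_top; assumption?)+

lemma gev_powr_law:
  assumes "0 < a"
  obtains M where "real_distribution M" "\<And>x. measure M {..x} = gev_cdf \<gamma> x powr a"
proof -
  let ?F = "\<lambda>x. gev_cdf \<gamma> x powr a"
  have mono: "?F x \<le> ?F y" if "x \<le> y" for x y
    using assms gev_cdf_mono[OF that] gev_cdf_nonneg by (intro powr_mono2) auto
  have rc: "continuous (at_right x) ?F" for x
    using gev_cdf_right_cont[of x \<gamma>] assms gev_cdf_nonneg unfolding continuous_within
    by (intro tendsto_powr') auto
  have bot: "(?F \<longlongrightarrow> 0) at_bot"
    using tendsto_powr'[OF gev_cdf_at_bot[of \<gamma>] tendsto_const[of a]] assms gev_cdf_nonneg by auto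
  have top: "(?F \<longlongrightarrow> 1) at_top"
    using tendsto_powr'[OF gev_cdf_at_top[of \<gamma>] tendsto_const[of a]] by auto
  show thesis
  proof (rule that)
    show "real_distribution (interval_measure ?F)"
      by (rule real_distribution_interval_measure[OF mono rc bot top])
    show "measure (interval_measure ?F) {..x} = ?F x" for x
      using cdf_interval_measure[OF mono rc bot] by (simp add: cdf_def fun_eq_iff)
  qed
qed

lemma min_powr_eq:
  fixes u v z :: real
  assumes "0 \<le> u" "u \<le> v" "0 \<le> z" "z \<le> 1"
  shows "min (u powr z * v) (u * v powr z) = u * v powr z"
proof (cases "u = 0")
  case True
  then show ?thesis using assms by (simp add: min_def)
next
  case False
  then have "u > 0" "v > 0" using assms by auto
  then have "u * v powr z = u powr z * (u powr (1 - z) * v powr z)"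
    by (simp add: powr_add[symmetric] mult.assoc[symmetric])
  also have "\<dots> \<le> u powr z * (v powr (1 - z) * v powr z)"
    using assms by (intro mult_left_mono mult_right_mono powr_mono2) auto
  also have "\<dots> = u powr z * v"
    using \<open>v > 0\<close> by (simp add: powr_add[symmetric])
  finally show ?thesis by simp
qed

lemma marshall_olkin_eq:
  assumes "0 \<le> u" "0 \<le> v" "0 < z" "z < 1"
  shows "marshall_olkin (1 - z) (1 - z) u v = u powr z * v powr z * min u v powr (1 - z)"
proof -
  have *: "marshall_olkin (1 - z) (1 - z) u v = u powr z * v powr z * u powr (1 - z)"
    if "0 \<le> u" "u \<le> v" for u v
    using that assms min_powr_eq[of u v z]
    by (cases "u = 0") (auto simp: marshall_olkin_def powr_add[symmetric] mult.commute mult.left_commute)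
  have sym: "marshall_olkin (1 - z) (1 - z) u v = marshall_olkin (1 - z) (1 - z) v u"
    by (simp add: marshall_olkin_def min.commute mult.commute)
  show ?thesis
  proof (cases "u \<le> v")
    case True
    then show ?thesis using *[of u v] assms by (simp add: min_def)
  next
    case False
    then show ?thesis using *[of v u] assms sym by (simp add: min_def mult.commute)
  qed
qed

lemma marshall_olkin_1: "0 \<le> u \<Longrightarrow> 0 \<le> v \<Longrightarrow> marshall_olkin 1 1 u v = min u v"
  by (auto simp: marshall_olkin_def min_def)

lemma gev_cdf_min: "min (gev_cdf \<gamma> x) (gev_cdf \<gamma> y) = gev_cdf \<gamma> (min x y)"
  using gev_cdf_mono[of x y \<gamma>] gev_cdf_mono[of y x \<gamma>] by (auto simp: min_def)

lemma measure_pair_Times: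
  assumes "prob_space M" "prob_space N" "A \<in> sets M" "B \<in> sets N"
  shows "measure (M \<Otimes>\<^sub>M N) (A \<times> B) = measure M A * measure N B"
proof -
  interpret N: prob_space N by fact
  show ?thesis
    using assms by (simp add: measure_def N.emeasure_pair_measure_Times enn2real_mult)
qed

(* Shock construction: (max A C, max B C) for independent A, B, C, where A and B
   have cdf G^\<zeta> and C has cdf G^(1-\<zeta>), G being the GEV cdf. *)
lemma ex_has_biv_cdf_biv_gev:
  assumes "0 \<le> \<zeta>" "\<zeta> \<le> 1"
  shows "\<exists>M. has_biv_cdf M (biv_gev_cdf \<zeta> \<gamma>)"
proof -
  interpret G: real_distribution "gev \<gamma>" by (rule real_distribution_gev)
  have G: "measure (gev \<gamma>) {..x} = gev_cdf \<gamma> x" for x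
    using cdf_gev by (simp add: cdf_def fun_eq_iff)
  consider "\<zeta> = 0" | "\<zeta> = 1" | "0 < \<zeta>" "\<zeta> < 1" using assms by linarith
  then show ?thesis
  proof cases
    case 1
    let ?M = "distr (gev \<gamma>) borel (\<lambda>x. (x, x))"
    have m: "(\<lambda>x. (x, x)) \<in> measurable (gev \<gamma>) (borel :: (real \<times> real) measure)"
      by (simp add: gev_def borel_prod[symmetric])
    have "measure ?M ({..x} \<times> {..y}) = biv_gev_cdf \<zeta> \<gamma> x y" for x y
    proof -
      have "measure ?M ({..x} \<times> {..y}) = measure (gev \<gamma>) ((\<lambda>x. (x, x)) -` ({..x} \<times> {..y}) \<inter> space (gev \<gamma>))"
        by (rule measure_distr[OF m]) (auto intro!: borel_closed closed_Times)
      also have "(\<lambda>x. (x, x)) -` ({..x} \<times> {..y}) \<inter> space (gev \<gamma>) = {..min x y}"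
        by (auto simp: gev_def)
      finally show ?thesis
        using 1 by (simp add: G biv_gev_cdf_def marshall_olkin_1 gev_cdf_nonneg gev_cdf_min)
    qed
    then show ?thesis
      using G.prob_space_distr[OF m] by (auto simp: has_biv_cdf_def)
  next
    case 2
    interpret P: pair_prob_space "gev \<gamma>" "gev \<gamma>" ..
    have "measure (gev \<gamma> \<Otimes>\<^sub>M gev \<gamma>) ({..x} \<times> {..y}) = biv_gev_cdf \<zeta> \<gamma> x y" for x y
      using 2 gev_cdf_nonneg[of \<gamma>]
      by (simp add: measure_pair_Times[OF G.prob_space_axioms G.prob_space_axioms] G biv_gev_cdf_def marshall_olkin_def)
    moreover have "sets (gev \<gamma> \<Otimes>\<^sub>M gev \<gamma>) = sets (borel :: (real \<times> real) measure)"
      unfolding borel_prod[symmetric] by (intro sets_pair_measure_cong) (auto simp: gev_def)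
    ultimately show ?thesis
      using P.prob_space_axioms by (auto simp: has_biv_cdf_def)
  next
    case 3
    obtain A where A: "real_distribution A" "\<And>x. measure A {..x} = gev_cdf \<gamma> x powr \<zeta>"
      using gev_powr_law[of \<zeta>] 3 by blast
    obtain C where C: "real_distribution C" "\<And>x. measure C {..x} = gev_cdf \<gamma> x powr (1 - \<zeta>)"
      using gev_powr_law[of "1 - \<zeta>"] 3 by auto
    interpret A: real_distribution A by fact
    interpret C: real_distribution C by fact
    interpret AA: pair_prob_space A A ..
    interpret AAC: pair_prob_space "A \<Otimes>\<^sub>M A" C ..
    let ?P = "(A \<Otimes>\<^sub>M A) \<Otimes>\<^sub>M C"
    let ?f = "\<lambda>((a, b), c). (max a c, max b c)"
    have m: "?f \<in> measurable ?P (borel :: (real \<times> real) measure)"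
      unfolding borel_prod[symmetric] case_prod_beta by measurable
    have "measure (distr ?P borel ?f) ({..x} \<times> {..y}) = biv_gev_cdf \<zeta> \<gamma> x y" for x y
    proof -
      have "measure (distr ?P borel ?f) ({..x} \<times> {..y}) = measure ?P (?f -` ({..x} \<times> {..y}) \<inter> space ?P)"
        by (rule measure_distr[OF m]) (auto intro!: borel_closed closed_Times)
      also have "?f -` ({..x} \<times> {..y}) \<inter> space ?P = ({..x} \<times> {..y}) \<times> {..min x y}"
        by (auto simp: space_pair_measure)
      also have "measure ?P \<dots> = measure (A \<Otimes>\<^sub>M A) ({..x} \<times> {..y}) * measure C {..min x y}"
        by (rule measure_pair_Times) (auto intro: AA.prob_space_axioms C.prob_space_axioms)
      also have "measure (A \<Otimes>\<^sub>M A) ({..x} \<times> {..y}) = measure A {..x} * measure A {..y}"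
        by (rule measure_pair_Times) (auto intro: A.prob_space_axioms)
      finally show ?thesis
        using 3 by (simp add: A C biv_gev_cdf_def marshall_olkin_eq gev_cdf_nonneg gev_cdf_min)
    qed
    then show ?thesis
      using AAC.prob_space_distr[OF m] by (auto simp: has_biv_cdf_def)
  qed
qed

lemma has_biv_cdf_biv_gev:
  assumes "0 \<le> \<zeta>" "\<zeta> \<le> 1"
  shows "has_biv_cdf (biv_law (biv_gev_cdf \<zeta> \<gamma>)) (biv_gev_cdf \<zeta> \<gamma>)"
  using ex_has_biv_cdf_biv_gev[OF assms] biv_law_eqI by metis

end

theory Submission
  imports Defs
begin

text \<open>
  Write \<open>u\<close> for the GEV cdf. The bivariate cdf is \<open>u a * u b * u (max a b) powr (\<zeta> - 1)\<close>, so for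
  a step function \<open>\<Sum>a. c a * indicator {..a}\<close> the covariance of its values at the two coordinates
  is the quadratic form in \<open>c a * u a\<close> with kernel \<open>u (max a b) powr (\<zeta> - 1) - 1\<close>, and its variance
  is the one with kernel \<open>1 / u (max a b) - 1\<close>. A kernel \<open>\<psi> (max a b)\<close> with \<open>\<psi>\<close> nonnegative and
  antitone is positive semidefinite. This applies to the covariance kernel and to \<open>1 - \<zeta>\<close> times the
  variance kernel minus the covariance kernel, so that
  \<open>0 \<le> Cov (f Y1, f Y2) \<le> (1 - \<zeta>) * Var (f Y1)\<close>; by density of step functions this holds for every
  square-integrable \<open>f\<close>. Integrating over \<open>\<zeta>\<close> gives the inequality, and equality forces
  \<open>Corr (h Y1, h Y2) = 1 - \<zeta>\<close> almost everywhere. Positive semidefiniteness also bounds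
  every \<open>Corr (f Y1, g Y2)\<close> by \<open>1 - \<zeta>\<close>, so \<open>h\<close> then attains the maximal correlation.
\<close>

section \<open>Square-integrable functions and approximation by step functions\<close>

text \<open>Measurability is demanded separately, since integrability of
  \<open>(f x)\<^sup>2\<close> determines \<open>f\<close> only up to a pointwise sign and does not
  imply it.\<close>

definition square_integrable :: "'a measure \<Rightarrow> ('a \<Rightarrow> real) \<Rightarrow> bool" where
  "square_integrable M f \<longleftrightarrow> f \<in> borel_measurable M \<and> integrable M (\<lambda>x. (f x)\<^sup>2)"

lemma square_integrable_measurable [measurable_dest]:
  "square_integrable M f \<Longrightarrow> f \<in> borel_measurable M"
  by (simp add: square_integrable_def)

lemma square_integrable_mult:
  assumes f: "square_integrable M f" and g: "square_integrable M g"
  shows "integrable M (\<lambda>x. f x * g x)"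
proof (rule Bochner_Integration.integrable_bound)
  show "integrable M (\<lambda>x. (f x)\<^sup>2 + (g x)\<^sup>2)"
    using f g by (auto simp: square_integrable_def)
  show "(\<lambda>x. f x * g x) \<in> borel_measurable M"
    using f g by measurable
  have "\<bar>a * b\<bar> \<le> a\<^sup>2 + b\<^sup>2" for a b :: real
  proof -
    have "2 * (\<bar>a\<bar> * \<bar>b\<bar>) \<le> a\<^sup>2 + b\<^sup>2"
      using sum_squares_bound[of "\<bar>a\<bar>" "\<bar>b\<bar>"] by simp
    moreover have "0 \<le> \<bar>a\<bar> * \<bar>b\<bar>" by simp
    ultimately show ?thesis unfolding abs_mult by linarith
  qed
  then show "AE x in M. norm (f x * g x) \<le> norm ((f x)\<^sup>2 + (g x)\<^sup>2)"
    by auto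
qed

lemma square_integrable_bound:
  assumes g: "square_integrable M g" and f: "f \<in> borel_measurable M" and le: "\<And>x. \<bar>f x\<bar> \<le> \<bar>g x\<bar>"
  shows "square_integrable M f"
  unfolding square_integrable_def
proof
  show "integrable M (\<lambda>x. (f x)\<^sup>2)"
  proof (rule Bochner_Integration.integrable_bound)
    show "integrable M (\<lambda>x. (g x)\<^sup>2)" using g by (simp add: square_integrable_def)
    show "AE x in M. norm ((f x)\<^sup>2) \<le> norm ((g x)\<^sup>2)"
      using le by (simp add: abs_le_square_iff[symmetric])
  qed (use f in simp)
qed (rule f)

lemma square_integrable_cmult:
  "square_integrable M f \<Longrightarrow> square_integrable M (\<lambda>x. c * f x)"
  by (auto simp: square_integrable_def power_mult_distrib)

lemma square_integrable_add:
  assumes f: "square_integrable M f" and g: "square_integrable M g"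
  shows "square_integrable M (\<lambda>x. f x + g x)"
  using assms square_integrable_mult[OF f g]
  by (auto simp: square_integrable_def power2_sum mult.assoc)

lemma square_integrable_diff:
  assumes f: "square_integrable M f" and g: "square_integrable M g"
  shows "square_integrable M (\<lambda>x. f x - g x)"
  using square_integrable_add[OF f square_integrable_cmult[OF g, of "-1"]] by simp

lemma square_integrable_sum:
  assumes "\<And>i. i \<in> I \<Longrightarrow> square_integrable M (f i)"
  shows "square_integrable M (\<lambda>x. \<Sum>i\<in>I. f i x)"
  using assms
proof (induction I rule: infinite_finite_induct)
  case (insert i I)
  then show ?case by (simp add: square_integrable_add)
qed (simp_all add: square_integrable_def)

lemma square_integrable_bounded:
  assumes "finite_measure M" "f \<in> borel_measurable M" "\<And>x. \<bar>f x\<bar> \<le> B"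
  shows "square_integrable M f"
proof -
  interpret finite_measure M by fact
  have "integrable M (\<lambda>x. (f x)\<^sup>2)"
    using assms(2) by (intro integrable_const_bound[where B = "B\<^sup>2"])
      (auto intro!: abs_le_square_iff[THEN iffD1] order_trans[OF assms(3)])
  then show ?thesis using assms(2) by (simp add: square_integrable_def)
qed

lemma square_integrable_distr:
  assumes "T \<in> measurable M N" "square_integrable (distr M N T) f"
  shows "square_integrable M (\<lambda>x. f (T x))"
  using assms by (auto simp: square_integrable_def integrable_distr_eq)

lemma integral_square_add_le:
  assumes f: "square_integrable M f" and g: "square_integrable M g"
  shows "(\<integral>x. (f x + g x)\<^sup>2 \<partial>M) \<le> 2 * (\<integral>x. (f x)\<^sup>2 \<partial>M) + 2 * (\<integral>x. (g x)\<^sup>2 \<partial>M)"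
proof -
  have "(a + b)\<^sup>2 \<le> 2 * a\<^sup>2 + 2 * b\<^sup>2" for a b :: real
    using sum_squares_bound[of a b] by (simp add: power2_sum)
  then have "(\<integral>x. (f x + g x)\<^sup>2 \<partial>M) \<le> (\<integral>x. 2 * (f x)\<^sup>2 + 2 * (g x)\<^sup>2 \<partial>M)"
    using f g square_integrable_add[OF f g]
    by (intro integral_mono) (auto simp: square_integrable_def)
  then show ?thesis using f g by (simp add: square_integrable_def)
qed

lemma integral_Cauchy_Schwarz:
  assumes f: "square_integrable M f" and g: "square_integrable M g"
  shows "\<bar>\<integral>x. f x * g x \<partial>M\<bar> \<le> sqrt (\<integral>x. (f x)\<^sup>2 \<partial>M) * sqrt (\<integral>x. (g x)\<^sup>2 \<partial>M)"
proof -
  let ?a = "\<integral>x. (f x)\<^sup>2 \<partial>M" and ?b = "\<integral>x. (g x)\<^sup>2 \<partial>M" and ?c = "\<integral>x. f x * g x \<partial>M"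
  have q: "0 \<le> s\<^sup>2 * ?a + 2 * s * t * ?c + t\<^sup>2 * ?b" for s t
  proof -
    have "0 \<le> (\<integral>x. (s * f x + t * g x)\<^sup>2 \<partial>M)" by simp
    also have "\<dots> = (\<integral>x. s\<^sup>2 * (f x)\<^sup>2 + (2 * s * t) * (f x * g x) + t\<^sup>2 * (g x)\<^sup>2 \<partial>M)"
      by (simp add: power2_sum power_mult_distrib algebra_simps)
    also have "\<dots> = s\<^sup>2 * ?a + (2 * s * t) * ?c + t\<^sup>2 * ?b"
      using f g square_integrable_mult[OF f g] by (simp add: square_integrable_def)
    finally show ?thesis .
  qed
  have a0: "0 \<le> ?a" and b0: "0 \<le> ?b" by simp_all
  have "?c\<^sup>2 \<le> ?a * ?b"
  proof (cases "?b = 0")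
    case True
    have "?c = 0"
    proof (rule ccontr)
      assume c: "?c \<noteq> 0"
      \<comment> \<open>With \<open>?b = 0\<close> the form is affine in \<open>t\<close>, and a
        nonzero \<open>?c\<close> lets \<open>t\<close> be chosen so that its value is
        \<open>- 1\<close>.\<close>
      have "0 \<le> ?a + 2 * (- (?a + 1) / (2 * ?c)) * ?c"
        using q[of 1 "- (?a + 1) / (2 * ?c)"] True by simp
      also have "\<dots> = - 1" using c by (simp add: field_simps)
      finally show False by simp
    qed
    then show ?thesis using True by simp
  next
    case False
    \<comment> \<open>The choice \<open>s = ?b\<close>, \<open>t = - ?c\<close> minimises the form
      up to scaling and leaves the discriminant.\<close>
    have "0 \<le> ?b * (?a * ?b - ?c\<^sup>2)" using q[of ?b "- ?c"] by (simp add: power2_eq_square algebra_simps)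
    then show ?thesis using False b0 by (simp add: zero_le_mult_iff)
  qed
  from real_sqrt_le_mono[OF this] show ?thesis by (simp only: real_sqrt_abs real_sqrt_mult)
qed

text \<open>Continuity of the inner product: \<open>F n * G n\<close> differs from
  \<open>f * g\<close> by three products that each contain \<open>f - F n\<close> or
  \<open>g - G n\<close>, and Cauchy-Schwarz sends each of them to \<open>0\<close>. It serves for
  mean, second moment and joint moment alike.\<close>

lemma tendsto_integral_mult:
  assumes f: "square_integrable M f" and g: "square_integrable M g"
    and F: "\<And>n. square_integrable M (F n)" and G: "\<And>n. square_integrable M (G n)"
    and limF: "(\<lambda>n. \<integral>x. (f x - F n x)\<^sup>2 \<partial>M) \<longlonglongrightarrow> 0"
    and limG: "(\<lambda>n. \<integral>x. (g x - G n x)\<^sup>2 \<partial>M) \<longlonglongrightarrow> 0"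
  shows "(\<lambda>n. \<integral>x. F n x * G n x \<partial>M) \<longlonglongrightarrow> (\<integral>x. f x * g x \<partial>M)"
proof -
  let ?n = "\<lambda>h. sqrt (\<integral>x. (h x)\<^sup>2 \<partial>M)"
  have d: "square_integrable M (\<lambda>x. f x - F n x)" "square_integrable M (\<lambda>x. g x - G n x)" for n
    using f g F G by (auto intro: square_integrable_diff)
  have eq: "(\<integral>x. F n x * G n x \<partial>M) = (\<integral>x. f x * g x \<partial>M) - (\<integral>x. f x * (g x - G n x) \<partial>M)
      - (\<integral>x. (f x - F n x) * g x \<partial>M) + (\<integral>x. (f x - F n x) * (g x - G n x) \<partial>M)" for n
    using square_integrable_mult[OF f g] square_integrable_mult[OF f G[of n]]
      square_integrable_mult[OF F[of n] g] square_integrable_mult[OF F[of n] G[of n]]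
    by (simp add: algebra_simps)
  have nF: "(\<lambda>n. ?n (\<lambda>x. f x - F n x)) \<longlonglongrightarrow> 0" and nG: "(\<lambda>n. ?n (\<lambda>x. g x - G n x)) \<longlonglongrightarrow> 0"
    using tendsto_real_sqrt[OF limF] tendsto_real_sqrt[OF limG] by simp_all
  have "(\<lambda>n. \<integral>x. f x * (g x - G n x) \<partial>M) \<longlonglongrightarrow> 0"
    using tendsto_mult_right_zero[OF nG, of "?n f"]
    by (rule Lim_null_comparison[rotated]) (auto intro!: always_eventually integral_Cauchy_Schwarz f d)
  moreover have "(\<lambda>n. \<integral>x. (f x - F n x) * g x \<partial>M) \<longlonglongrightarrow> 0"
    using tendsto_mult_left_zero[OF nF, of "?n g"]
    by (rule Lim_null_comparison[rotated]) (auto intro!: always_eventually integral_Cauchy_Schwarz g d)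
  moreover have "(\<lambda>n. \<integral>x. (f x - F n x) * (g x - G n x) \<partial>M) \<longlonglongrightarrow> 0"
    using tendsto_mult_zero[OF nF nG]
    by (rule Lim_null_comparison[rotated]) (auto intro!: always_eventually integral_Cauchy_Schwarz d)
  ultimately show ?thesis
    unfolding eq by (auto intro!: tendsto_eq_intros)
qed

text \<open>Half-lines are taken as building blocks because integrals of their products are values
  of the cdf, while they still generate the Borel sets.\<close>

definition step_fun :: "(real \<Rightarrow> real) \<Rightarrow> real set \<Rightarrow> real \<Rightarrow> real" where
  "step_fun c I x = (\<Sum>a\<in>I. c a * indicator {..a} x)"

lemma step_fun_measurable [measurable]: "step_fun c I \<in> borel_measurable borel"
  unfolding step_fun_def by measurable


lemma step_fun_single: "step_fun c {a} x = c a * indicator {..a} x"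
  by (simp add: step_fun_def del: sum_mult_indicator)

lemma step_fun_extend:
  assumes "finite J" "I \<subseteq> J"
  shows "step_fun c I = step_fun (\<lambda>a. if a \<in> I then c a else 0) J"
  using assms unfolding step_fun_def
  by (intro ext sum.mono_neutral_cong_left) auto

lemma step_fun_add:
  assumes "finite I" "finite J"
  obtains e K where "finite K" "\<And>x. step_fun c I x + step_fun d J x = step_fun e K x"
proof
  show "finite (I \<union> J)" using assms by simp
  show "step_fun c I x + step_fun d J x = step_fun
      (\<lambda>a. (if a \<in> I then c a else 0) + (if a \<in> J then d a else 0)) (I \<union> J) x" for x
    using assms step_fun_extend[of "I \<union> J" I c] step_fun_extend[of "I \<union> J" J d]
    by (simp add: step_fun_def sum.distrib distrib_right del: sum_mult_indicator)
qed

lemma step_fun_cmult: "r * step_fun c I x = step_fun (\<lambda>a. r * c a) I x"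
  by (simp add: step_fun_def sum_distrib_left mult.assoc)

section \<open>Density of step functions in the square-integrable functions\<close>

context real_distribution
begin

text \<open>The closure of the step functions in the mean square sense; it turns out to be the whole
  space.\<close>

definition step_approximable :: "(real \<Rightarrow> real) \<Rightarrow> bool" where
  "step_approximable f \<longleftrightarrow> square_integrable M f \<and>
     (\<forall>e>0. \<exists>c I. finite I \<and> (\<integral>x. (f x - step_fun c I x)\<^sup>2 \<partial>M) < e)"

lemma square_integrable_step_fun: "square_integrable M (step_fun c I)"
  unfolding step_fun_def[abs_def]
proof (rule square_integrable_sum, rule square_integrable_cmult)
  show "square_integrable M (indicator {..a})" for a
    by (rule square_integrable_bounded[OF finite_measure_axioms, where B = 1])
      (auto simp: indicator_def)
qed

lemma step_approximable_limit:
  assumes f: "square_integrable M f"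
    and lim: "\<And>e. e > 0 \<Longrightarrow> \<exists>g. step_approximable g \<and> (\<integral>x. (f x - g x)\<^sup>2 \<partial>M) < e"
  shows "step_approximable f"
  unfolding step_approximable_def
proof (intro conjI f allI impI)
  fix e :: real assume "e > 0"
  \<comment> \<open>Two errors below \<open>e / 4\<close>, each doubled by
    \<open>integral_square_add_le\<close>, add up to less than \<open>e\<close>.\<close>
  then obtain g where g: "step_approximable g" "(\<integral>x. (f x - g x)\<^sup>2 \<partial>M) < e / 4"
    using lim[of "e / 4"] by auto
  then obtain c I where I: "finite I" "(\<integral>x. (g x - step_fun c I x)\<^sup>2 \<partial>M) < e / 4"
    using \<open>e > 0\<close> unfolding step_approximable_def by (meson divide_pos_pos zero_less_numeral)
  have g2: "square_integrable M g" using g by (simp add: step_approximable_def)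
  have "(\<integral>x. (f x - step_fun c I x)\<^sup>2 \<partial>M) < e"
    using integral_square_add_le[OF square_integrable_diff[OF f g2]
        square_integrable_diff[OF g2 square_integrable_step_fun[of c I]]] g(2) I(2) by simp
  then show "\<exists>c I. finite I \<and> (\<integral>x. (f x - step_fun c I x)\<^sup>2 \<partial>M) < e" using I(1) by blast
qed

lemma step_approximable_LIMSEQ:
  assumes f: "square_integrable M f" and F: "\<And>n. step_approximable (F n)"
    and lim: "(\<lambda>n. \<integral>x. (f x - F n x)\<^sup>2 \<partial>M) \<longlonglongrightarrow> 0"
  shows "step_approximable f"
proof (rule step_approximable_limit[OF f])
  fix e :: real assume "e > 0"
  then have "\<forall>\<^sub>F n in sequentially. (\<integral>x. (f x - F n x)\<^sup>2 \<partial>M) < e"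
    by (rule order_tendstoD[OF lim])
  then obtain n where "(\<integral>x. (f x - F n x)\<^sup>2 \<partial>M) < e"
    by (auto simp: eventually_sequentially)
  then show "\<exists>g. step_approximable g \<and> (\<integral>x. (f x - g x)\<^sup>2 \<partial>M) < e" using F by blast
qed

text \<open>Dominated convergence with majorant \<open>(2 * w x)\<^sup>2\<close> turns pointwise
  into mean square convergence. This is the tool for half-lines growing to the whole line, for
  countable unions and for monotone limits.\<close>

lemma step_approximable_dominated:
  assumes [measurable]: "f \<in> borel_measurable borel" and F: "\<And>n. step_approximable (F n)"
    and w: "square_integrable M w" and le: "\<And>n x. \<bar>F n x\<bar> \<le> w x"
    and lim: "\<And>x. (\<lambda>n. F n x) \<longlonglongrightarrow> f x"
  shows "step_approximable f"
proof -
  have fw: "\<bar>f x\<bar> \<le> w x" for x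
    by (rule tendsto_upperbound[OF tendsto_rabs[OF lim]]) (auto simp: le)
  have f: "square_integrable M f"
    by (rule square_integrable_bound[OF w]) (auto intro: order_trans[OF fw])
  have Fm: "F n \<in> borel_measurable M" for n
    using F by (auto simp: step_approximable_def square_integrable_def)
  have "(\<lambda>n. \<integral>x. (f x - F n x)\<^sup>2 \<partial>M) \<longlonglongrightarrow> (\<integral>x. 0 \<partial>M)"
  proof (rule integral_dominated_convergence[where w = "\<lambda>x. (2 * w x)\<^sup>2"])
    show "integrable M (\<lambda>x. (2 * w x)\<^sup>2)"
      using square_integrable_cmult[OF w, of 2] unfolding square_integrable_def by (rule conjunct2)
    show "AE x in M. (\<lambda>n. (f x - F n x)\<^sup>2) \<longlonglongrightarrow> 0"
      by (auto intro!: tendsto_eq_intros lim)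
    have "\<bar>f x - F n x\<bar> \<le> 2 * w x" for x n
      using fw[of x] le[of n x] by linarith
    from power_mono[OF this abs_ge_zero, of _ _ 2]
    show "AE x in M. norm ((f x - F n x)\<^sup>2) \<le> (2 * w x)\<^sup>2" for n by simp
  qed (use Fm in auto)
  then show ?thesis
    using step_approximable_LIMSEQ[OF f F] by simp
qed

lemma step_approximable_step_fun: "finite I \<Longrightarrow> step_approximable (step_fun c I)"
  unfolding step_approximable_def using square_integrable_step_fun[of c I]
  by (auto intro!: exI[of _ c] exI[of _ I])

lemma step_approximable_add:
  assumes f: "step_approximable f" and g: "step_approximable g"
  shows "step_approximable (\<lambda>x. f x + g x)"
proof -
  have f2: "square_integrable M f" and g2: "square_integrable M g"
    using f g by (auto simp: step_approximable_def)
  show ?thesis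
    unfolding step_approximable_def
  proof (intro conjI square_integrable_add f2 g2 allI impI)
    fix e :: real assume "e > 0"
    then have "e / 4 > 0" by simp
    with f g obtain c I d J where I: "finite I" "(\<integral>x. (f x - step_fun c I x)\<^sup>2 \<partial>M) < e / 4"
      and J: "finite J" "(\<integral>x. (g x - step_fun d J x)\<^sup>2 \<partial>M) < e / 4"
      unfolding step_approximable_def by meson
    obtain b K where K: "finite K" "\<And>x. step_fun c I x + step_fun d J x = step_fun b K x"
      using step_fun_add[OF I(1) J(1)] by metis
    have "(\<integral>x. (f x + g x - step_fun b K x)\<^sup>2 \<partial>M)
        = (\<integral>x. ((f x - step_fun c I x) + (g x - step_fun d J x))\<^sup>2 \<partial>M)"
      by (simp add: K(2)[symmetric] algebra_simps)
    also have "\<dots> < e"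
      using integral_square_add_le[OF square_integrable_diff[OF f2 square_integrable_step_fun[of c I]]
          square_integrable_diff[OF g2 square_integrable_step_fun[of d J]]] I(2) J(2) by simp
    finally show "\<exists>c I. finite I \<and> (\<integral>x. (f x + g x - step_fun c I x)\<^sup>2 \<partial>M) < e"
      using K(1) by blast
  qed
qed

lemma step_approximable_cmult:
  assumes f: "step_approximable f"
  shows "step_approximable (\<lambda>x. r * f x)"
proof (cases "r = 0")
  case True
  then show ?thesis
    using step_approximable_step_fun[of "{}" "\<lambda>_. 0"] by (simp add: step_fun_def[abs_def])
next
  case False
  show ?thesis
    unfolding step_approximable_def
  proof (intro conjI square_integrable_cmult allI impI)
    show "square_integrable M f" using f by (simp add: step_approximable_def)
    fix e :: real assume "e > 0"
    then have "e / r\<^sup>2 > 0" using False by simp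
    with f obtain c I where I: "finite I" "(\<integral>x. (f x - step_fun c I x)\<^sup>2 \<partial>M) < e / r\<^sup>2"
      unfolding step_approximable_def by meson
    have "(\<integral>x. (r * f x - step_fun (\<lambda>a. r * c a) I x)\<^sup>2 \<partial>M)
        = r\<^sup>2 * (\<integral>x. (f x - step_fun c I x)\<^sup>2 \<partial>M)"
      by (simp add: step_fun_cmult[symmetric] right_diff_distrib[symmetric] power_mult_distrib)
    also have "\<dots> < e" using I(2) False by (simp add: field_simps)
    finally show "\<exists>c I. finite I \<and> (\<integral>x. (r * f x - step_fun c I x)\<^sup>2 \<partial>M) < e"
      using I(1) by blast
  qed
qed

text \<open>The constant is not itself a finite combination of half-lines \<open>{..a}\<close>, only
  the limit of the indicators of \<open>{..real n}\<close>. It is what makes complements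
  accessible.\<close>

lemma step_approximable_const: "step_approximable (\<lambda>_. 1)"
proof (rule step_approximable_dominated[where F = "\<lambda>n. step_fun (\<lambda>_. 1) {real n}" and w = "\<lambda>_. 1"])
  fix x :: real
  show "(\<lambda>n. step_fun (\<lambda>_. 1) {real n} x) \<longlonglongrightarrow> 1"
  proof (rule tendsto_eventually)
    obtain N where "x \<le> real N" using real_arch_simple by blast
    then show "\<forall>\<^sub>F n in sequentially. step_fun (\<lambda>_. 1) {real n} x = 1"
      by (auto simp: eventually_sequentially step_fun_single intro!: exI[of _ N])
  qed
qed (auto intro: step_approximable_step_fun simp: step_fun_single square_integrable_def indicator_def)

text \<open>Half-lines form an intersection-stable generator, so Dynkin induction applies. In the
  union case disjointness turns partial sums into indicators, which keeps them below the majorant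
  \<open>1\<close>.\<close>

lemma step_approximable_indicator:
  assumes "A \<in> sets borel"
  shows "step_approximable (indicator A)"
proof -
  have "Int_stable (range (\<lambda>a::real. {..a}))"
    by (rule Int_stableI) (auto simp: image_iff)
  moreover have "range (\<lambda>a::real. {..a}) \<subseteq> Pow UNIV" by simp
  moreover have "A \<in> sigma_sets UNIV (range (\<lambda>a::real. {..a}))"
    using assms by (subst (asm) borel_eq_atMost) simp
  ultimately show ?thesis
  proof (induction rule: sigma_sets_induct_disjoint)
    case (basic A)
    then obtain a where "A = {..a}" by auto
    then have "indicator A = step_fun (\<lambda>_. 1) {a}" by (auto simp: step_fun_single)
    then show ?case using step_approximable_step_fun by simp
  next
    case empty
    show ?case using step_approximable_step_fun[of "{}" "\<lambda>_. 0"] by (simp add: step_fun_def[abs_def] indicator_def[abs_def])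
  next
    case (compl A)
    have "indicator (UNIV - A) = (\<lambda>x. 1 + (- 1) * indicator A x :: real)"
      by (auto simp: indicator_def)
    then show ?case
      using step_approximable_add[OF step_approximable_const step_approximable_cmult[OF compl(2), of "-1"]] by simp
  next
    case (union A)
    have A: "A i \<in> sets borel" for i
      using union(2) by (subst borel_eq_atMost) auto
    show ?case
    proof (rule step_approximable_dominated[where w = "\<lambda>_. 1"
          and F = "\<lambda>n x. \<Sum>i<n. indicator (A i) x"])
      show "step_approximable (\<lambda>x. \<Sum>i<n. indicator (A i) x)" for n
      proof (induction n)
        case 0
        show ?case using step_approximable_cmult[OF step_approximable_const, of 0] by simp
      next
        case (Suc n)
        show ?case using step_approximable_add[OF Suc union(3)[of n]] by simp
      qed
      show "\<bar>\<Sum>i<n. indicat_real (A i) x\<bar> \<le> 1" for n x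
        using union(1) by (subst indicator_UN_disjoint[symmetric])
          (auto simp: disjoint_family_on_def indicator_def)
      show "(\<lambda>n. \<Sum>i<n. indicat_real (A i) x) \<longlonglongrightarrow> indicator (\<Union>i. A i) x" for x
      proof -
        have "(\<lambda>n. indicat_real (\<Union>i<n. A i) x) \<longlonglongrightarrow> indicator (\<Union>i. A i) x"
          by (rule LIMSEQ_indicator_UN)
        moreover have "(\<Sum>i<n. indicat_real (A i) x) = indicator (\<Union>i<n. A i) x" for n
          using union(1) by (subst indicator_UN_disjoint)
            (auto simp: disjoint_family_on_def)
        ultimately show ?thesis by simp
      qed
    qed (use A in \<open>auto simp: square_integrable_def\<close>)
  qed
qed

text \<open>Induction over nonnegative Borel functions. Every piece lies below the function being
  built and inherits square-integrability from it.\<close>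

lemma step_approximable_nonneg:
  assumes "f \<in> borel_measurable borel" "\<And>x. 0 \<le> f x" "square_integrable M f"
  shows "step_approximable f"
  using assms
proof (induction rule: borel_measurable_induct_real)
  case (set A)
  then show ?case by (intro step_approximable_indicator)
next
  case (mult u c)
  show ?case
  proof (cases "c = 0")
    case True
    then show ?thesis using step_approximable_cmult[OF step_approximable_const, of 0] by simp
  next
    case False
    then have "square_integrable M u"
      using square_integrable_cmult[OF mult.prems, of "1 / c"] by simp
    then show ?thesis by (intro step_approximable_cmult mult)
  qed
next
  case (add u v)
  have "square_integrable M u" "square_integrable M v"
    using add.hyps by (auto intro!: square_integrable_bound[OF add.prems])
  then show ?case by (intro step_approximable_add add.IH)
next
  case (seq U)
  have le: "U i x \<le> f x" for i x
    using seq by (intro incseq_le) (auto simp: incseq_def le_fun_def)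
  have "square_integrable M (U i)" for i
    using seq.hyps by (intro square_integrable_bound[OF seq.prems])
      (auto intro: order_trans[OF le])
  then have "step_approximable (U i)" for i by (rule seq.IH)
  then show ?case
    by (rule step_approximable_dominated[OF assms(1) _ seq.prems]) (use seq.hyps le in auto)
qed

lemma square_integrable_imp_step_approximable:
  assumes f: "square_integrable M f"
  shows "step_approximable f"
proof -
  have m: "f \<in> borel_measurable borel" using f measurable_cong_sets[OF events_eq_borel refl] unfolding square_integrable_def by blast
  \<comment> \<open>The values \<open>s = 1\<close> and \<open>s = - 1\<close> treat positive and
    negative part at once.\<close>
  have "square_integrable M (\<lambda>x. max 0 (s * f x))" if "\<bar>s\<bar> = 1" for s
  proof (rule square_integrable_bound[OF f])
    have "\<bar>max 0 z\<bar> \<le> \<bar>z\<bar>" for z :: real by (simp add: max_def)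
    then show "\<bar>max 0 (s * f x)\<bar> \<le> \<bar>f x\<bar>" for x
      using that by (metis abs_mult mult_1)
  qed (use m in simp)
  then have "step_approximable (\<lambda>x. max 0 (s * f x))" if "\<bar>s\<bar> = 1" for s
    using that m by (intro step_approximable_nonneg) auto
  from this[of 1] this[of "-1"]
  have "step_approximable (\<lambda>x. max 0 (1 * f x) + (- 1) * max 0 (- 1 * f x))"
    by (intro step_approximable_add step_approximable_cmult) auto
  moreover have "max 0 (1 * y) + (- 1) * max 0 (- 1 * y) = y" for y :: real
    by (simp add: max_def)
  ultimately show ?thesis by simp
qed

lemma square_integrable_step_sequence:
  assumes "square_integrable M f"
  obtains c I where "\<And>n. finite (I n)"
    "(\<lambda>n. \<integral>x. (f x - step_fun (c n) (I n) x)\<^sup>2 \<partial>M) \<longlonglongrightarrow> 0"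
proof -
  have "\<forall>n. \<exists>c I. finite I \<and> (\<integral>x. (f x - step_fun c I x)\<^sup>2 \<partial>M) < inverse (real (Suc n))"
    using square_integrable_imp_step_approximable[OF assms]
    unfolding step_approximable_def by (meson inverse_positive_iff_positive of_nat_0_less_iff zero_less_Suc)
  then obtain c I where I: "\<And>n. finite (I n)"
    "\<And>n. (\<integral>x. (f x - step_fun (c n) (I n) x)\<^sup>2 \<partial>M) < inverse (real (Suc n))"
    by metis
  have "(\<lambda>n. \<integral>x. (f x - step_fun (c n) (I n) x)\<^sup>2 \<partial>M) \<longlonglongrightarrow> 0"
    by (rule tendsto_sandwich[OF _ _ tendsto_const LIMSEQ_inverse_real_of_nat])
      (auto intro!: always_eventually less_imp_le[OF I(2)] simp del: of_nat_Suc)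
  with I(1) that show thesis by blast
qed

end

section \<open>Kernels depending on the maximum\<close>

text \<open>Induction that adds a new largest index \<open>b\<close>: all new terms carry the factor
  \<open>\<psi> b\<close>, so together with \<open>\<psi> b * ?s\<^sup>2\<close> they complete a
  square. The general lower bound \<open>t\<close>, instead of \<open>0\<close>, is what lets the
  induction go through.\<close>

lemma max_kernel_ge:
  fixes \<psi> :: "'a::linorder \<Rightarrow> real"
  assumes "finite I"
    and "\<And>a b. a \<in> I \<Longrightarrow> b \<in> I \<Longrightarrow> a \<le> b \<Longrightarrow> \<psi> b \<le> \<psi> a"
    and "\<And>a. a \<in> I \<Longrightarrow> t \<le> \<psi> a"
  shows "t * (\<Sum>a\<in>I. x a)\<^sup>2 \<le> (\<Sum>a\<in>I. \<Sum>b\<in>I. x a * x b * \<psi> (max a b))"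
  using assms
proof (induction I arbitrary: t rule: finite_linorder_max_induct)
  case empty
  then show ?case by simp
next
  case (insert b A)
  let ?s = "\<Sum>a\<in>A. x a" and ?S = "\<Sum>a\<in>A. \<Sum>c\<in>A. x a * x c * \<psi> (max a c)"
  have b: "b \<notin> A" using insert.hyps by auto
  have m: "max a b = b" "max b a = b" if "a \<in> A" for a
    using insert.hyps that by (auto simp: max_def)
  \<comment> \<open>The induction hypothesis with \<open>t\<close> replaced by
    \<open>\<psi> b\<close>, a lower bound of \<open>\<psi>\<close> on \<open>A\<close> because
    \<open>b\<close> exceeds all of \<open>A\<close>.\<close>
  have IH: "\<psi> b * ?s\<^sup>2 \<le> ?S"
    using insert.prems insert.hyps by (intro insert.IH) (auto intro: less_imp_le)
  have eq: "(\<Sum>a\<in>insert b A. \<Sum>c\<in>insert b A. x a * x c * \<psi> (max a c))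
      = ?S + 2 * x b * \<psi> b * ?s + (x b)\<^sup>2 * \<psi> b"
    using insert.hyps(1) b m
    by (simp add: sum.distrib sum_distrib_left sum_distrib_right power2_eq_square algebra_simps)
  have "t * (\<Sum>a\<in>insert b A. x a)\<^sup>2 \<le> \<psi> b * (x b + ?s)\<^sup>2"
    using insert.prems(2)[of b] insert.hyps(1) b by (auto intro!: mult_right_mono)
  also have "\<dots> \<le> ?S + 2 * x b * \<psi> b * ?s + (x b)\<^sup>2 * \<psi> b"
    using IH by (simp add: power2_sum algebra_simps)
  finally show ?case unfolding eq .
qed

text \<open>The conditions on \<open>\<psi>\<close> are imposed only where the weight is nonzero:
  the kernels below are powers of a cdf, and where the cdf vanishes the convention
  \<open>0 powr r = 0\<close> can break antitony. There the weight
  \<open>c a * gev_cdf \<gamma> a\<close> vanishes too.\<close>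

lemma max_kernel_nonneg:
  fixes \<psi> :: "'a::linorder \<Rightarrow> real"
  assumes I: "finite I"
    and anti: "\<And>a b. x a \<noteq> 0 \<Longrightarrow> x b \<noteq> 0 \<Longrightarrow> a \<le> b \<Longrightarrow> \<psi> b \<le> \<psi> a"
    and nonneg: "\<And>a. x a \<noteq> 0 \<Longrightarrow> 0 \<le> \<psi> a"
  shows "0 \<le> (\<Sum>a\<in>I. \<Sum>b\<in>I. x a * x b * \<psi> (max a b))"
proof -
  let ?J = "{a \<in> I. x a \<noteq> 0}"
  have "0 * (\<Sum>a\<in>?J. x a)\<^sup>2 \<le> (\<Sum>a\<in>?J. \<Sum>b\<in>?J. x a * x b * \<psi> (max a b))"
    using I anti nonneg by (intro max_kernel_ge) auto
  also have "\<dots> = (\<Sum>a\<in>I. \<Sum>b\<in>?J. x a * x b * \<psi> (max a b))"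
    using I by (intro sum.mono_neutral_left) auto
  also have "\<dots> = (\<Sum>a\<in>I. \<Sum>b\<in>I. x a * x b * \<psi> (max a b))"
    using I by (intro sum.cong refl sum.mono_neutral_left) auto
  finally show ?thesis by simp
qed

section \<open>The bivariate cdf as a kernel in the maximum\<close>

lemma biv_gev_cdf_commute: "biv_gev_cdf \<zeta> \<gamma> a b = biv_gev_cdf \<zeta> \<gamma> b a"
  by (simp add: biv_gev_cdf_def marshall_olkin_def min.commute mult.commute)

text \<open>For \<open>a \<le> b\<close> the minimum in the copula is
  \<open>gev_cdf \<gamma> a * gev_cdf \<gamma> b powr \<zeta>\<close> by \<open>min_powr_eq\<close>;
  splitting off one full factor at \<open>b\<close> leaves the exponent \<open>\<zeta> - 1\<close>.
  Up to weights, the cdf thus depends on \<open>max a b\<close> alone.\<close>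

lemma biv_gev_cdf_eq:
  assumes "0 \<le> \<zeta>" "\<zeta> \<le> 1"
  shows "biv_gev_cdf \<zeta> \<gamma> a b
    = gev_cdf \<gamma> a * gev_cdf \<gamma> b * gev_cdf \<gamma> (max a b) powr (\<zeta> - 1)"
proof -
  have *: "biv_gev_cdf \<zeta> \<gamma> a b
    = gev_cdf \<gamma> a * gev_cdf \<gamma> b * gev_cdf \<gamma> (max a b) powr (\<zeta> - 1)" if "a \<le> b" for a b
  proof (cases "gev_cdf \<gamma> b = 0")
    case True
    then show ?thesis by (simp add: biv_gev_cdf_def marshall_olkin_def)
  next
    case False
    then have "gev_cdf \<gamma> b * gev_cdf \<gamma> b powr (\<zeta> - 1) = gev_cdf \<gamma> b powr \<zeta>"
      using gev_cdf_nonneg[of \<gamma> b] powr_mult_base[of "gev_cdf \<gamma> b" "\<zeta> - 1"] by simp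
    then show ?thesis
      using min_powr_eq[OF gev_cdf_nonneg gev_cdf_mono[OF that] assms] that
      by (simp add: biv_gev_cdf_def marshall_olkin_def max_absorb2)
  qed
  show ?thesis
    using *[of a b] *[of b a] biv_gev_cdf_commute[of \<zeta> \<gamma> a b]
    by (cases "a \<le> b") (auto simp: max.commute mult.commute mult.left_commute)
qed

text \<open>The comonotone case \<open>\<zeta> = 0\<close>. It brings the second moment of the
  margin into the same form as the joint moment.\<close>

lemma gev_cdf_min_eq:
  "gev_cdf \<gamma> (min a b) = gev_cdf \<gamma> a * gev_cdf \<gamma> b * gev_cdf \<gamma> (max a b) powr (- 1)"
  using biv_gev_cdf_eq[of 0 \<gamma> a b] gev_cdf_nonneg[of \<gamma>]
  by (simp add: biv_gev_cdf_def marshall_olkin_1 gev_cdf_min)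

text \<open>In the variable \<open>w = 1 / t \<ge> 1\<close> the expression is
  \<open>(1 - z) * w + z - w powr (1 - z)\<close>, the gap between a concave power and its tangent
  at \<open>w = 1\<close>. The gap vanishes at \<open>1\<close> and widens with
  \<open>w\<close>.\<close>

lemma tangent_powr_antimono:
  fixes z s t :: real
  assumes "0 \<le> z" "z \<le> 1" "0 < s" "s \<le> t" "t \<le> 1"
  shows "(1 - z) * t powr (-1) + z - t powr (z - 1) \<le> (1 - z) * s powr (-1) + z - s powr (z - 1)"
proof (rule DERIV_nonpos_imp_nonincreasing[OF assms(4)])
  fix r assume r: "s \<le> r" "r \<le> t"
  then have r0: "0 < r" "r \<le> 1" using assms by auto
  let ?d = "(1 - z) * (r powr (z - 2) - r powr (-2))"
  have "((\<lambda>r. (1 - z) * r powr (-1) + z - r powr (z - 1)) has_real_derivative ?d) (at r)"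
    by (rule DERIV_cong[OF DERIV_diff[OF DERIV_add[OF DERIV_cmult[OF
          has_real_derivative_powr[OF r0(1)]] DERIV_const] has_real_derivative_powr[OF r0(1)]]])
      (simp add: algebra_simps)
  moreover have "?d \<le> 0"
    using r0 assms by (auto intro!: mult_nonneg_nonpos powr_mono')
  ultimately show "\<exists>y. ((\<lambda>r. (1 - z) * r powr (-1) + z - r powr (z - 1)) has_real_derivative y) (at r) \<and> y \<le> 0"
    by blast
qed

text \<open>One formula for two uses: the coordinates under the bivariate law, and
  \<open>X = Y\<close> for second moments of the margin.\<close>

lemma integral_step_fun_mult:
  assumes "finite_measure M" "finite I" "finite J"
    and X: "X \<in> borel_measurable M" and Y: "Y \<in> borel_measurable M"
  shows "(\<integral>p. step_fun c I (X p) * step_fun d J (Y p) \<partial>M)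
    = (\<Sum>a\<in>I. \<Sum>b\<in>J. c a * d b * measure M {p \<in> space M. X p \<le> a \<and> Y p \<le> b})"
proof -
  interpret finite_measure M by fact
  have meas: "{p \<in> space M. X p \<le> a \<and> Y p \<le> b} \<in> sets M" for a b
    using X Y by measurable
  have "(\<integral>p. step_fun c I (X p) * step_fun d J (Y p) \<partial>M)
    = (\<integral>p. (\<Sum>a\<in>I. \<Sum>b\<in>J. c a * d b * indicator {p \<in> space M. X p \<le> a \<and> Y p \<le> b} p) \<partial>M)"
    unfolding step_fun_def sum_product
    by (intro Bochner_Integration.integral_cong refl sum.cong) (auto simp: indicator_def)
  also have "\<dots> = (\<Sum>a\<in>I. \<Sum>b\<in>J. c a * d b * measure M {p \<in> space M. X p \<le> a \<and> Y p \<le> b})"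
    using meas by (subst Bochner_Integration.integral_sum)
     (auto intro!: integrable_sum sum.cong
       simp: Bochner_Integration.integral_sum emeasure_eq_measure simp del: sum_mult_indicator)
  finally show ?thesis .
qed

lemma measurable_biv_gev_cdf [measurable]:
  "(\<lambda>\<zeta>. biv_gev_cdf \<zeta> \<gamma> a b) \<in> borel_measurable borel"
  unfolding biv_gev_cdf_def marshall_olkin_def by measurable

lemma measure_gev_atMost: "measure (gev \<gamma>) {..x} = gev_cdf \<gamma> x"
  unfolding cdf_gev[symmetric] by (simp add: cdf_def)

section \<open>The bivariate law of two sliding block maxima\<close>

text \<open>\<open>M\<close> is any measure with the given cdf; the definite description
  \<open>biv_law\<close> enters only by interpretation, through
  \<open>biv_gev_biv_law\<close>.\<close>

locale biv_gev =
  fixes \<zeta> \<gamma> :: real and M :: "(real \<times> real) measure"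
  assumes zeta: "0 \<le> \<zeta>" "\<zeta> \<le> 1" and M: "has_biv_cdf M (biv_gev_cdf \<zeta> \<gamma>)"
begin

sublocale prob_space M using M by (simp add: has_biv_cdf_def)

sublocale gev: real_distribution "gev \<gamma>" by (rule real_distribution_gev)

lemma sets_M [measurable_cong]: "sets M = sets (borel \<Otimes>\<^sub>M borel)"
  using M by (simp only: has_biv_cdf_def borel_prod)

lemma space_M [simp]: "space M = UNIV"
  using sets_eq_imp_space_eq[OF sets_M] by (simp add: space_pair_measure)

text \<open>The cdf is symmetric and determines the law. Exchangeability gives the second margin
  from the first and the symmetry of the covariance form.\<close>

lemma swap_M: "distr M borel prod.swap = M"
proof (rule has_biv_cdf_unique[OF _ M])
  have [measurable]: "prod.swap \<in> measurable M (borel \<Otimes>\<^sub>M borel)"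
    unfolding prod.swap_def by measurable
  have m: "prod.swap \<in> measurable M borel"
    unfolding borel_prod[symmetric] by measurable
  have "measure (distr M borel prod.swap) ({..x} \<times> {..y}) = measure M ({..y} \<times> {..x})" for x y
    using m by (subst measure_distr) (auto intro!: borel_closed closed_Times arg_cong[of _ _ "measure M"])
  then show "has_biv_cdf (distr M borel prod.swap) (biv_gev_cdf \<zeta> \<gamma>)"
    using M prob_space_distr[OF m] by (auto simp: has_biv_cdf_def biv_gev_cdf_commute)
qed

text \<open>The marginal cdf is the limit of the bivariate one as the second argument runs through
  \<open>real n\<close> to infinity.\<close>

lemma distr_fst: "distr M borel fst = gev \<gamma>"
proof (rule cdf_unique)
  show "real_distribution (distr M borel fst)"
    by (rule real_distribution_distr) simp
  show "real_distribution (gev \<gamma>)" by (rule real_distribution_gev)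
  show "cdf (distr M borel fst) = cdf (gev \<gamma>)"
  proof
    fix x
    have "(\<lambda>n. measure M ({..x} \<times> {..real n})) \<longlonglongrightarrow> measure M (\<Union>n. {..x} \<times> {..real n})"
      by (rule finite_Lim_measure_incseq) (auto simp: incseq_def sets_M)
    moreover have "(\<Union>n. {..x} \<times> {..real n}) = fst -` {..x} \<inter> space M"
      using real_arch_simple by auto
    moreover have "(\<lambda>n. measure M ({..x} \<times> {..real n})) \<longlonglongrightarrow> gev_cdf \<gamma> x"
    proof -
      have v: "(\<lambda>n. gev_cdf \<gamma> (real n)) \<longlonglongrightarrow> 1"
        by (rule filterlim_compose[OF gev_cdf_at_top filterlim_real_sequentially])
      have "(\<lambda>n. min (gev_cdf \<gamma> x powr \<zeta> * gev_cdf \<gamma> (real n)) (gev_cdf \<gamma> x * gev_cdf \<gamma> (real n) powr \<zeta>))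
        \<longlonglongrightarrow> min (gev_cdf \<gamma> x powr \<zeta> * 1) (gev_cdf \<gamma> x * 1 powr \<zeta>)"
        by (intro tendsto_intros v) auto
      \<comment> \<open>Since the cdf is at most \<open>1\<close>, raising it to the power
        \<open>\<zeta> \<le> 1\<close> does not decrease it, so the second term is the
        minimum.\<close>
      also have "min (gev_cdf \<gamma> x powr \<zeta> * 1) (gev_cdf \<gamma> x * 1 powr \<zeta>) = gev_cdf \<gamma> x"
        using min_powr_eq[OF gev_cdf_nonneg gev_cdf_le_1 zeta, of \<gamma> x] by simp
      finally show ?thesis
        using M by (simp add: has_biv_cdf_def biv_gev_cdf_def marshall_olkin_def)
    qed
    ultimately have "measure M (fst -` {..x} \<inter> space M) = gev_cdf \<gamma> x"
      using LIMSEQ_unique by metis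
    then show "cdf (distr M borel fst) x = cdf (gev \<gamma>) x"
      unfolding cdf_gev by (simp add: cdf_def measure_distr)
  qed
qed

lemma distr_snd: "distr M borel snd = gev \<gamma>"
proof -
  have "prod.swap \<in> measurable M (borel :: (real \<times> real) measure)"
    unfolding borel_prod[symmetric] prod.swap_def by measurable
  moreover have "snd \<in> measurable (borel :: (real \<times> real) measure) (borel :: real measure)"
    "fst \<in> measurable (borel :: (real \<times> real) measure) (borel :: real measure)"
    unfolding borel_prod[symmetric] by measurable
  ultimately have "distr (distr M borel prod.swap) borel snd = distr M borel (snd \<circ> prod.swap)"
    by (intro distr_distr)
  then show ?thesis by (simp add: swap_M distr_fst comp_def)
qed

lemma
  assumes f: "f \<in> borel_measurable borel"
  shows integral_fst: "(\<integral>p. f (fst p) \<partial>M) = (\<integral>x. (f x :: real) \<partial>gev \<gamma>)"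
    and integral_snd: "(\<integral>p. f (snd p) \<partial>M) = (\<integral>x. f x \<partial>gev \<gamma>)"
    and integrable_fst_iff: "integrable M (\<lambda>p. f (fst p)) \<longleftrightarrow> integrable (gev \<gamma>) f"
    and integrable_snd_iff: "integrable M (\<lambda>p. f (snd p)) \<longleftrightarrow> integrable (gev \<gamma>) f"
  using f integral_distr[of fst M borel f] integral_distr[of snd M borel f]
    integrable_distr_eq[of fst M borel f] integrable_distr_eq[of snd M borel f]
  by (simp_all add: distr_fst distr_snd)

lemma square_integrable_fst:
  "square_integrable (gev \<gamma>) f \<Longrightarrow> square_integrable M (\<lambda>p. f (fst p))"
  using square_integrable_distr[of fst M borel f] by (simp add: distr_fst)

lemma square_integrable_snd:
  "square_integrable (gev \<gamma>) f \<Longrightarrow> square_integrable M (\<lambda>p. f (snd p))"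
  using square_integrable_distr[of snd M borel f] by (simp add: distr_snd)

lemma measurable_gev: "square_integrable (gev \<gamma>) f \<Longrightarrow> f \<in> borel_measurable borel"
  using measurable_cong_sets[OF gev.events_eq_borel refl] unfolding square_integrable_def by blast

lemma integral_joint_step_fun:
  assumes "finite I"
  shows "(\<integral>p. step_fun c I (fst p) * step_fun c I (snd p) \<partial>M)
    = (\<Sum>a\<in>I. \<Sum>b\<in>I. c a * c b * biv_gev_cdf \<zeta> \<gamma> a b)"
proof -
  have "{p \<in> space M. fst p \<le> a \<and> snd p \<le> b} = {..a} \<times> {..b}" for a b by auto
  then show ?thesis
    using integral_step_fun_mult[OF finite_measure_axioms assms assms, of fst snd c c] M
    by (simp add: has_biv_cdf_def)
qed

lemma integral_step_fun_square:
  assumes "finite I"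
  shows "(\<integral>x. (step_fun c I x)\<^sup>2 \<partial>gev \<gamma>) = (\<Sum>a\<in>I. \<Sum>b\<in>I. c a * c b * gev_cdf \<gamma> (min a b))"
proof -
  have "{p \<in> space (gev \<gamma>). p \<le> a \<and> p \<le> b} = {..min a b}" for a b by auto
  then show ?thesis
    using integral_step_fun_mult[OF gev.finite_measure_axioms assms assms, of "\<lambda>x. x" "\<lambda>x. x" c c]
    by (simp add: power2_eq_square measure_gev_atMost)
qed

lemma integral_step_fun:
  assumes "finite I"
  shows "(\<integral>x. step_fun c I x \<partial>gev \<gamma>) = (\<Sum>a\<in>I. c a * gev_cdf \<gamma> a)"
  unfolding step_fun_def
  by (subst Bochner_Integration.integral_sum)
    (auto simp: gev.emeasure_eq_measure measure_gev_atMost simp del: sum_mult_indicator)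

text \<open>With weights \<open>x a = c a * gev_cdf \<gamma> a\<close> the joint moment, the second
  moment and the squared mean are quadratic forms whose kernels are the powers
  \<open>\<zeta> - 1\<close>, \<open>- 1\<close> and \<open>0\<close> of the cdf at the maximum.
  Both claims are then instances of \<open>max_kernel_nonneg\<close>.\<close>

lemma joint_step_fun_bounds:
  fixes c :: "real \<Rightarrow> real"
  assumes I: "finite I"
  defines "s \<equiv> step_fun c I"
  defines "m \<equiv> \<integral>x. s x \<partial>gev \<gamma>" and "J \<equiv> \<integral>p. s (fst p) * s (snd p) \<partial>M"
  shows "m\<^sup>2 \<le> J" and "J - m\<^sup>2 \<le> (1 - \<zeta>) * ((\<integral>x. (s x)\<^sup>2 \<partial>gev \<gamma>) - m\<^sup>2)"
proof -
  let ?u = "gev_cdf \<gamma>"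
  define x where "x a = c a * ?u a" for a
  have pos: "0 < ?u a" if "x a \<noteq> 0" for a
    using that gev_cdf_nonneg[of \<gamma> a] by (auto simp: x_def less_le)
  have J: "J = (\<Sum>a\<in>I. \<Sum>b\<in>I. x a * x b * ?u (max a b) powr (\<zeta> - 1))"
    unfolding J_def s_def integral_joint_step_fun[OF I]
    by (simp add: biv_gev_cdf_eq[OF zeta] x_def mult_ac)
  have Q: "(\<integral>x. (s x)\<^sup>2 \<partial>gev \<gamma>) = (\<Sum>a\<in>I. \<Sum>b\<in>I. x a * x b * ?u (max a b) powr (-1))"
    unfolding s_def integral_step_fun_square[OF I]
    by (simp only: gev_cdf_min_eq x_def mult_ac)
  have m: "m\<^sup>2 = (\<Sum>a\<in>I. \<Sum>b\<in>I. x a * x b * 1)"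
    unfolding m_def s_def integral_step_fun[OF I] by (simp add: power2_eq_square sum_product x_def)
  have "0 \<le> (\<Sum>a\<in>I. \<Sum>b\<in>I. x a * x b * (?u (max a b) powr (\<zeta> - 1) - 1))"
  proof (rule max_kernel_nonneg[OF I])
    fix a assume "x a \<noteq> 0"
    then have a: "0 < ?u a" by (rule pos)
    show "0 \<le> ?u a powr (\<zeta> - 1) - 1"
      using powr_mono2'[of "\<zeta> - 1" "?u a" 1] a zeta gev_cdf_le_1[of \<gamma> a] by simp
    fix b assume "a \<le> b"
    then show "?u b powr (\<zeta> - 1) - 1 \<le> ?u a powr (\<zeta> - 1) - 1"
      using a zeta by (auto intro!: powr_mono2' gev_cdf_mono)
  qed
  then show "m\<^sup>2 \<le> J"
    unfolding J m by (simp add: right_diff_distrib sum_subtractf)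
  have "0 \<le> (\<Sum>a\<in>I. \<Sum>b\<in>I. x a * x b *
      ((1 - \<zeta>) * ?u (max a b) powr (-1) + \<zeta> - ?u (max a b) powr (\<zeta> - 1)))"
  proof (rule max_kernel_nonneg[OF I])
    fix a assume "x a \<noteq> 0"
    then have a: "0 < ?u a" by (rule pos)
    \<comment> \<open>The kernel vanishes where the cdf equals \<open>1\<close>, so antitony already
      gives nonnegativity.\<close>
    show "0 \<le> (1 - \<zeta>) * ?u a powr (-1) + \<zeta> - ?u a powr (\<zeta> - 1)"
      using tangent_powr_antimono[OF zeta a gev_cdf_le_1 order_refl] by simp
    fix b assume "a \<le> b"
    then show "(1 - \<zeta>) * ?u b powr (-1) + \<zeta> - ?u b powr (\<zeta> - 1)
        \<le> (1 - \<zeta>) * ?u a powr (-1) + \<zeta> - ?u a powr (\<zeta> - 1)"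
      using a by (intro tangent_powr_antimono zeta gev_cdf_mono gev_cdf_le_1)
  qed
  also have "\<dots> = (1 - \<zeta>) * (\<integral>x. (s x)\<^sup>2 \<partial>gev \<gamma>) + \<zeta> * m\<^sup>2 - J"
    unfolding J m Q sum_distrib_left sum.distrib[symmetric] sum_subtractf[symmetric]
    by (intro sum.cong refl) (simp add: algebra_simps)
  finally show "J - m\<^sup>2 \<le> (1 - \<zeta>) * ((\<integral>x. (s x)\<^sup>2 \<partial>gev \<gamma>) - m\<^sup>2)"
    by (simp add: algebra_simps)
qed

text \<open>Both margins are \<open>gev \<gamma>\<close>, so mean square convergence under the
  margin carries over to either coordinate, whatever the dependence between them.\<close>

lemma tendsto_joint:
  assumes f: "square_integrable (gev \<gamma>) f" and F: "\<And>n. square_integrable (gev \<gamma>) (F n)"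
    and lim: "(\<lambda>n. \<integral>x. (f x - F n x)\<^sup>2 \<partial>gev \<gamma>) \<longlonglongrightarrow> 0"
  shows "(\<lambda>n. \<integral>p. F n (fst p) * F n (snd p) \<partial>M) \<longlonglongrightarrow> (\<integral>p. f (fst p) * f (snd p) \<partial>M)"
proof (rule tendsto_integral_mult)
  have [measurable]: "f \<in> borel_measurable borel" "F n \<in> borel_measurable borel" for n
    using f F by (auto intro: measurable_gev)
  show "(\<lambda>n. \<integral>p. (f (fst p) - F n (fst p))\<^sup>2 \<partial>M) \<longlonglongrightarrow> 0"
    using lim by (subst integral_fst) auto
  show "(\<lambda>n. \<integral>p. (f (snd p) - F n (snd p))\<^sup>2 \<partial>M) \<longlonglongrightarrow> 0"
    using lim by (subst integral_snd) auto
qed (use f F in \<open>auto intro: square_integrable_fst square_integrable_snd\<close>)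

text \<open>Both inequalities are non-strict between quantities continuous in mean square, so they
  pass from step functions to their limits.\<close>

lemma joint_bounds:
  assumes f: "square_integrable (gev \<gamma>) f"
  defines "m \<equiv> \<integral>x. f x \<partial>gev \<gamma>" and "J \<equiv> \<integral>p. f (fst p) * f (snd p) \<partial>M"
  shows "m\<^sup>2 \<le> J" and "J - m\<^sup>2 \<le> (1 - \<zeta>) * ((\<integral>x. (f x)\<^sup>2 \<partial>gev \<gamma>) - m\<^sup>2)"
proof -
  obtain c I where I: "\<And>n. finite (I n)"
    and lim: "(\<lambda>n. \<integral>x. (f x - step_fun (c n) (I n) x)\<^sup>2 \<partial>gev \<gamma>) \<longlonglongrightarrow> 0"
    by (rule gev.square_integrable_step_sequence[OF f]) blast
  let ?s = "\<lambda>n. step_fun (c n) (I n)"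
  have s: "square_integrable (gev \<gamma>) (?s n)" for n
    by (rule gev.square_integrable_step_fun)
  have one: "square_integrable (gev \<gamma>) (\<lambda>_. 1)"
    by (simp add: square_integrable_def)
  have J: "(\<lambda>n. \<integral>p. ?s n (fst p) * ?s n (snd p) \<partial>M) \<longlonglongrightarrow> J"
    unfolding J_def by (rule tendsto_joint[OF f s lim])
  \<comment> \<open>The mean is the inner product with the constant \<open>1\<close>.\<close>
  have m: "(\<lambda>n. \<integral>x. ?s n x \<partial>gev \<gamma>) \<longlonglongrightarrow> m"
    using tendsto_integral_mult[OF f one s one lim] by (simp add: m_def)
  have Q: "(\<lambda>n. \<integral>x. (?s n x)\<^sup>2 \<partial>gev \<gamma>) \<longlonglongrightarrow> (\<integral>x. (f x)\<^sup>2 \<partial>gev \<gamma>)"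
    using tendsto_integral_mult[OF f f s s lim lim] by (simp add: power2_eq_square)
  show "m\<^sup>2 \<le> J"
    by (rule tendsto_le[OF _ J tendsto_power[OF m]])
      (auto intro!: always_eventually joint_step_fun_bounds I)
  show "J - m\<^sup>2 \<le> (1 - \<zeta>) * ((\<integral>x. (f x)\<^sup>2 \<partial>gev \<gamma>) - m\<^sup>2)"
    by (rule tendsto_le[OF _ tendsto_mult[OF tendsto_const tendsto_diff[OF Q tendsto_power[OF m]]]
        tendsto_diff[OF J tendsto_power[OF m]]])
      (auto intro!: always_eventually joint_step_fun_bounds I)
qed

end

section \<open>Covariances and variances as moments\<close>

lemma cov_eq_integral_mult:
  assumes "prob_space M" and X: "square_integrable M X" and Y: "square_integrable M Y"
  shows "cov M X Y = (\<integral>x. X x * Y x \<partial>M) - (\<integral>x. X x \<partial>M) * (\<integral>x. Y x \<partial>M)"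
proof -
  interpret prob_space M by fact
  have one: "square_integrable M (\<lambda>_. 1)" by (simp add: square_integrable_def)
  have "integrable M X" "integrable M Y" "integrable M (\<lambda>x. X x * Y x)"
    using square_integrable_mult[OF X one] square_integrable_mult[OF Y one]
      square_integrable_mult[OF X Y] by simp_all
  then show ?thesis by (simp add: cov_def algebra_simps prob_space)
qed

lemma var_eq_cov: "var M X = cov M X X"
  by (simp add: var_def cov_def power2_eq_square)

lemma var_eq_integral_square:
  assumes "prob_space M" and X: "square_integrable M X"
  shows "var M X = (\<integral>x. (X x)\<^sup>2 \<partial>M) - (\<integral>x. X x \<partial>M)\<^sup>2"
  using cov_eq_integral_mult[OF assms X] by (simp add: var_eq_cov power2_eq_square)

text \<open>On a probability space constants are square-integrable, so centring changes nothing, and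
  \<open>X = X * 1\<close> is integrable as a product. This translates the side conditions in
  \<open>max_corr\<close>.\<close>

lemma has_variance_iff_square_integrable:
  assumes "prob_space M"
  shows "has_variance M X \<longleftrightarrow> square_integrable M X"
proof -
  interpret prob_space M by fact
  have one: "square_integrable M (\<lambda>_. 1)" by (simp add: square_integrable_def)
  let ?m = "\<integral>x. X x \<partial>M"
  show ?thesis
  proof
    assume v: "has_variance M X"
    then have X: "integrable M X" and "square_integrable M (\<lambda>x. X x - ?m)"
      by (auto simp: has_variance_def square_integrable_def)
    then show "square_integrable M X"
      using square_integrable_add[OF _ square_integrable_cmult[OF one, of ?m], of "\<lambda>x. X x - ?m"] by simp
  next
    assume X: "square_integrable M X"
    then show "has_variance M X"
      using square_integrable_mult[OF X one] square_integrable_diff[OF X square_integrable_cmult[OF one, of ?m]]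
      by (simp add: has_variance_def square_integrable_def)
  qed
qed

section \<open>Bounds for covariances and correlations\<close>

context biv_gev
begin

lemma cov_eq:
  assumes f: "square_integrable (gev \<gamma>) f" and g: "square_integrable (gev \<gamma>) g"
  shows "cov M (\<lambda>p. f (fst p)) (\<lambda>p. g (snd p))
    = (\<integral>p. f (fst p) * g (snd p) \<partial>M) - (\<integral>x. f x \<partial>gev \<gamma>) * (\<integral>x. g x \<partial>gev \<gamma>)"
  using cov_eq_integral_mult[OF prob_space_axioms square_integrable_fst[OF f] square_integrable_snd[OF g]]
  by (simp add: integral_fst integral_snd measurable_gev f g)

lemma var_fst: "f \<in> borel_measurable borel \<Longrightarrow> var M (\<lambda>p. f (fst p)) = var (gev \<gamma>) f"
  and var_snd: "f \<in> borel_measurable borel \<Longrightarrow> var M (\<lambda>p. f (snd p)) = var (gev \<gamma>) f"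
  unfolding var_def
  using integral_fst[of "\<lambda>x. (f x - (\<integral>x. f x \<partial>gev \<gamma>))\<^sup>2"]
    integral_snd[of "\<lambda>x. (f x - (\<integral>x. f x \<partial>gev \<gamma>))\<^sup>2"]
  by (simp_all add: integral_fst integral_snd)

lemma cov_nonneg:
  assumes "square_integrable (gev \<gamma>) f"
  shows "0 \<le> cov M (\<lambda>p. f (fst p)) (\<lambda>p. f (snd p))"
  using joint_bounds(1)[OF assms] by (simp add: cov_eq assms power2_eq_square)

lemma cov_le_var:
  assumes "square_integrable (gev \<gamma>) f"
  shows "cov M (\<lambda>p. f (fst p)) (\<lambda>p. f (snd p)) \<le> (1 - \<zeta>) * var (gev \<gamma>) f"
  using joint_bounds(2)[OF assms] var_eq_integral_square[OF gev.prob_space_axioms assms]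
  by (simp add: cov_eq assms power2_eq_square)

lemma cov_commute:
  assumes [measurable]: "f \<in> borel_measurable borel" "g \<in> borel_measurable borel"
  shows "cov M (\<lambda>p. f (fst p)) (\<lambda>p. g (snd p)) = cov M (\<lambda>p. g (fst p)) (\<lambda>p. f (snd p))"
proof -
  let ?a = "\<integral>x. f x \<partial>gev \<gamma>" and ?b = "\<integral>x. g x \<partial>gev \<gamma>"
  have m: "prod.swap \<in> measurable M (borel :: (real \<times> real) measure)"
    "(\<lambda>p. (f (fst p) - ?a) * (g (snd p) - ?b)) \<in> borel_measurable (borel :: (real \<times> real) measure)"
    unfolding borel_prod[symmetric] prod.swap_def by measurable
  have "(\<integral>p. (f (fst p) - ?a) * (g (snd p) - ?b) \<partial>M)
    = (\<integral>p. (f (snd p) - ?a) * (g (fst p) - ?b) \<partial>M)"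
    using integral_distr[OF m] by (simp add: swap_M)
  then show ?thesis
    by (simp add: cov_def integral_fst integral_snd mult.commute)
qed

text \<open>The mixed term is controlled by the diagonal ones: \<open>2 * r * s * Cov (f, g)\<close>
  is at most \<open>r\<^sup>2 * Cov (f, f) + s\<^sup>2 * Cov (g, g)\<close>, and
  \<open>cov_le_var\<close> bounds each summand by \<open>1 - \<zeta>\<close>.\<close>

lemma corr_le:
  assumes f: "square_integrable (gev \<gamma>) f" "0 < var (gev \<gamma>) f"
    and g: "square_integrable (gev \<gamma>) g" "0 < var (gev \<gamma>) g"
  shows "corr M (\<lambda>p. f (fst p)) (\<lambda>p. g (snd p)) \<le> 1 - \<zeta>"
proof -
  let ?c = "\<lambda>f g. cov M (\<lambda>p. f (fst p)) (\<lambda>p. g (snd p))"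
  define r s where "r = 1 / sqrt (var (gev \<gamma>) f)" and "s = 1 / sqrt (var (gev \<gamma>) g)"
  let ?h = "\<lambda>x. r * f x - s * g x"
  have h: "square_integrable (gev \<gamma>) ?h"
    by (intro square_integrable_diff square_integrable_cmult f g)
  have one: "square_integrable (gev \<gamma>) (\<lambda>_. 1)" by (simp add: square_integrable_def)
  have i: "integrable (gev \<gamma>) f" "integrable (gev \<gamma>) g"
    using square_integrable_mult[OF f(1) one] square_integrable_mult[OF g(1) one] by simp_all
  have i2: "integrable M (\<lambda>p. a (fst p) * b (snd p))"
    if "square_integrable (gev \<gamma>) a" "square_integrable (gev \<gamma>) b" for a b
    using that by (intro square_integrable_mult square_integrable_fst square_integrable_snd)
  \<comment> \<open>By exchangeability, \<open>?c\<close> is a symmetric positive semidefinite form;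
    apply it to the difference of the standardised functions.\<close>
  have "?c ?h ?h = r\<^sup>2 * ?c f f - r * s * ?c f g - r * s * ?c g f + s\<^sup>2 * ?c g g"
    unfolding cov_eq[OF h h] cov_eq[OF f(1) f(1)] cov_eq[OF f(1) g(1)] cov_eq[OF g(1) f(1)] cov_eq[OF g(1) g(1)]
    using i i2[OF f(1) f(1)] i2[OF f(1) g(1)] i2[OF g(1) f(1)] i2[OF g(1) g(1)]
    by (simp add: algebra_simps power2_eq_square)
  with cov_nonneg[OF h] cov_commute[of f g] measurable_gev f g
  have "2 * (r * s * ?c f g) \<le> r\<^sup>2 * ?c f f + s\<^sup>2 * ?c g g" by simp
  also have "\<dots> \<le> r\<^sup>2 * ((1 - \<zeta>) * var (gev \<gamma>) f) + s\<^sup>2 * ((1 - \<zeta>) * var (gev \<gamma>) g)"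
    by (intro add_mono mult_left_mono cov_le_var f g) auto
  also have "\<dots> = 2 * (1 - \<zeta>)"
    using f g by (simp add: r_def s_def power_divide)
  finally have "r * s * ?c f g \<le> 1 - \<zeta>" by simp
  then show ?thesis
    using f g by (simp add: corr_def var_fst var_snd measurable_gev r_def s_def)
qed

end

section \<open>Measurability in \<zeta> and the maximal correlation\<close>

lemma biv_gev_biv_law:
  "0 \<le> \<zeta> \<Longrightarrow> \<zeta> \<le> 1 \<Longrightarrow> biv_gev \<zeta> \<gamma> (biv_law (biv_gev_cdf \<zeta> \<gamma>))"
  by (simp add: biv_gev_def has_biv_cdf_biv_gev)

text \<open>The approximating step functions are chosen under the margin, hence are the same for all
  \<zeta>. The covariance is therefore a pointwise limit in \<zeta> of linear combinations of cdf
  values, up to a constant.\<close>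

lemma measurable_cov_biv_gev:
  assumes h: "square_integrable (gev \<gamma>) h"
  shows "(\<lambda>\<zeta>. indicator {0..1} \<zeta> * cov (biv_law (biv_gev_cdf \<zeta> \<gamma>)) (\<lambda>p. h (fst p)) (\<lambda>p. h (snd p)))
    \<in> borel_measurable borel"
proof -
  interpret G: real_distribution "gev \<gamma>" by (rule real_distribution_gev)
  obtain c I where I: "\<And>n. finite (I n)"
    and lim: "(\<lambda>n. \<integral>x. (h x - step_fun (c n) (I n) x)\<^sup>2 \<partial>gev \<gamma>) \<longlonglongrightarrow> 0"
    by (rule G.square_integrable_step_sequence[OF h]) blast
  let ?m = "\<integral>x. h x \<partial>gev \<gamma>"
  \<comment> \<open>Only the joint moment is approximated; the product of the means is already that
    of \<open>h\<close>.\<close>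
  let ?S = "\<lambda>n \<zeta>. indicator {0..1} \<zeta> *
    ((\<Sum>a\<in>I n. \<Sum>b\<in>I n. c n a * c n b * biv_gev_cdf \<zeta> \<gamma> a b) - ?m * ?m)"
  show ?thesis
  proof (rule borel_measurable_LIMSEQ_real)
    show "?S n \<in> borel_measurable borel" for n by measurable
    fix \<zeta> :: real
    show "(\<lambda>n. ?S n \<zeta>) \<longlonglongrightarrow>
      indicator {0..1} \<zeta> * cov (biv_law (biv_gev_cdf \<zeta> \<gamma>)) (\<lambda>p. h (fst p)) (\<lambda>p. h (snd p))"
    proof (cases "\<zeta> \<in> {0..1}")
      case True
      then interpret B: biv_gev \<zeta> \<gamma> "biv_law (biv_gev_cdf \<zeta> \<gamma>)"
        by (auto intro: biv_gev_biv_law)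
      show ?thesis
        using B.tendsto_joint[OF h G.square_integrable_step_fun lim]
        by (auto simp: B.cov_eq[OF h h] B.integral_joint_step_fun[OF I] intro!: tendsto_intros)
    qed simp
  qed
qed

text \<open>Only the upper bound \<open>max_corr \<le> 1 - \<zeta>\<close> is ever needed: if \<open>h\<close> attains it,
  the supremum equals it.\<close>

lemma max_corr_biv_gev_eqI:
  assumes \<zeta>: "0 \<le> \<zeta>" "\<zeta> \<le> 1" and h: "square_integrable (gev \<gamma>) h" "0 < var (gev \<gamma>) h"
    and eq: "corr (biv_law (biv_gev_cdf \<zeta> \<gamma>)) (\<lambda>p. h (fst p)) (\<lambda>p. h (snd p)) = 1 - \<zeta>"
  shows "max_corr (biv_gev_cdf \<zeta> \<gamma>) = 1 - \<zeta>"
proof -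
  let ?M = "biv_law (biv_gev_cdf \<zeta> \<gamma>)"
  interpret B: biv_gev \<zeta> \<gamma> ?M using \<zeta> by (rule biv_gev_biv_law)
  have fst_iff: "has_variance ?M (\<lambda>p. f (fst p)) \<longleftrightarrow> square_integrable (gev \<gamma>) f"
    and snd_iff: "has_variance ?M (\<lambda>p. f (snd p)) \<longleftrightarrow> square_integrable (gev \<gamma>) f"
    if [measurable]: "f \<in> borel_measurable borel" for f
    unfolding has_variance_iff_square_integrable[OF B.prob_space_axioms] square_integrable_def
    using B.integrable_fst_iff[of "\<lambda>x. (f x)\<^sup>2"] B.integrable_snd_iff[of "\<lambda>x. (f x)\<^sup>2"] by simp_all
  have hm: "h \<in> borel_measurable borel" using h(1) by (rule B.measurable_gev)
  show ?thesis
    unfolding max_corr_def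
  proof (rule cSup_eq_maximum, goal_cases)
    case 1
    show ?case
      using hm h eq by (intro CollectI exI[of _ h]) (auto simp: fst_iff snd_iff B.var_fst B.var_snd)
  next
    case (2 x)
    then show ?case
      by (auto simp: fst_iff snd_iff B.var_fst B.var_snd intro!: B.corr_le)
  qed
qed

section \<open>Integration over \<zeta> and the case of equality\<close>

theorem theorem3p1:
  fixes \<gamma> :: real and h :: "real \<Rightarrow> real"
  assumes "h \<in> borel_measurable borel"
    and "integrable (gev \<gamma>) (\<lambda>x. (h x)\<^sup>2)"
  shows "sigma2_sb \<gamma> h \<le> sigma2_db \<gamma> h \<and>
    (sigma2_db \<gamma> h > 0 \<longrightarrow>
      (sigma2_sb \<gamma> h = sigma2_db \<gamma> h \<longleftrightarrow>
        (AE \<zeta> in lborel. \<zeta> \<in> {0..1} \<longrightarrow>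
          corr (biv_law (biv_gev_cdf \<zeta> \<gamma>)) (\<lambda>p. h (fst p)) (\<lambda>p. h (snd p))
            = max_corr (biv_gev_cdf \<zeta> \<gamma>) \<and>
          max_corr (biv_gev_cdf \<zeta> \<gamma>) = 1 - \<zeta>)))"
proof -
  interpret G: real_distribution "gev \<gamma>" by (rule real_distribution_gev)
  have h: "square_integrable (gev \<gamma>) h"
    using assms measurable_cong_sets[OF G.events_eq_borel refl] unfolding square_integrable_def by blast
  let ?V = "var (gev \<gamma>) h"
  let ?C = "\<lambda>\<zeta>. cov (biv_law (biv_gev_cdf \<zeta> \<gamma>)) (\<lambda>p. h (fst p)) (\<lambda>p. h (snd p))"
  let ?R = "\<lambda>\<zeta>. corr (biv_law (biv_gev_cdf \<zeta> \<gamma>)) (\<lambda>p. h (fst p)) (\<lambda>p. h (snd p))"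
  have C: "0 \<le> ?C \<zeta>" "?C \<zeta> \<le> (1 - \<zeta>) * ?V" and R: "?R \<zeta> = ?C \<zeta> / ?V"
    if "\<zeta> \<in> {0..1}" for \<zeta>
  proof -
    interpret B: biv_gev \<zeta> \<gamma> "biv_law (biv_gev_cdf \<zeta> \<gamma>)"
      using that by (auto intro: biv_gev_biv_law)
    \<comment> \<open>This makes \<open>sqrt ?V * sqrt ?V\<close>, the denominator of the
      correlation, equal to \<open>?V\<close>.\<close>
    have "0 \<le> ?V" by (simp add: var_def)
    then show "0 \<le> ?C \<zeta>" "?C \<zeta> \<le> (1 - \<zeta>) * ?V" "?R \<zeta> = ?C \<zeta> / ?V"
      using B.cov_nonneg[OF h] B.cov_le_var[OF h] assms(1)
      by (simp_all add: corr_def B.var_fst B.var_snd)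
  qed
  let ?I = "\<lambda>\<zeta>. indicator {0..1} \<zeta> * ((1 - \<zeta>) * ?V) :: real"
  let ?J = "\<lambda>\<zeta>. indicator {0..1} \<zeta> * ?C \<zeta> :: real"
  \<comment> \<open>The upper bound integrates to \<open>?V / 2\<close>, which the factor
    \<open>2\<close> in \<open>sigma2_sb\<close> turns into the disjoint blocks variance.\<close>
  have "has_bochner_integral lborel (\<lambda>\<zeta>. ((1 - \<zeta>) * ?V) * indicator {0..1} \<zeta>)
      ((1 - 1\<^sup>2 / 2) * ?V - (0 - 0\<^sup>2 / 2) * ?V)"
    by (rule has_bochner_integral_FTC_Icc_real[where F = "\<lambda>\<zeta>. (\<zeta> - \<zeta>\<^sup>2 / 2) * ?V"])
      (auto intro!: derivative_eq_intros continuous_intros)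
  then have I: "integrable lborel ?I" "(\<integral>\<zeta>. ?I \<zeta> \<partial>lborel) = ?V / 2"
    by (simp_all add: has_bochner_integral_iff mult.commute)
  have le: "0 \<le> ?J \<zeta>" "?J \<zeta> \<le> ?I \<zeta>" for \<zeta>
    using C[of \<zeta>] by (auto simp: indicator_def)
  \<comment> \<open>Integrability has to be secured: the Bochner integral of a non-integrable
    function is \<open>0\<close> by convention, and the difference below could not be split.\<close>
  have J: "integrable lborel ?J"
    using measurable_cov_biv_gev[OF h] le
    by (intro Bochner_Integration.integrable_bound[OF I(1)]) 
        (auto intro!: AE_I2 order_trans[OF le(2) abs_ge_self] simp: abs_of_nonneg)
  have sb: "sigma2_sb \<gamma> h = 2 * (\<integral>\<zeta>. ?J \<zeta> \<partial>lborel)"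
    by (simp add: sigma2_sb_def set_lebesgue_integral_def)
  have D: "(\<integral>\<zeta>. ?I \<zeta> - ?J \<zeta> \<partial>lborel) = (sigma2_db \<gamma> h - sigma2_sb \<gamma> h) / 2"
    using I J by (simp add: sb sigma2_db_def)
  have "0 \<le> (\<integral>\<zeta>. ?I \<zeta> - ?J \<zeta> \<partial>lborel)"
    using le(2) by (intro Bochner_Integration.integral_nonneg) simp
  then have "sigma2_sb \<gamma> h \<le> sigma2_db \<gamma> h" unfolding D by simp
  moreover have "sigma2_sb \<gamma> h = sigma2_db \<gamma> h \<longleftrightarrow>
        (AE \<zeta> in lborel. \<zeta> \<in> {0..1} \<longrightarrow>
          ?R \<zeta> = max_corr (biv_gev_cdf \<zeta> \<gamma>) \<and> max_corr (biv_gev_cdf \<zeta> \<gamma>) = 1 - \<zeta>)"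
    if V: "sigma2_db \<gamma> h > 0"
  proof -
    have V: "0 < ?V" using V by (simp add: sigma2_db_def)
    have "sigma2_sb \<gamma> h = sigma2_db \<gamma> h \<longleftrightarrow> (\<integral>\<zeta>. ?I \<zeta> - ?J \<zeta> \<partial>lborel) = 0"
      unfolding D by auto
    also have "\<dots> \<longleftrightarrow> (AE \<zeta> in lborel. ?I \<zeta> - ?J \<zeta> = 0)"
      using I(1) J le(2) by (intro integral_nonneg_eq_0_iff_AE) auto
    also have "\<dots> \<longleftrightarrow> (AE \<zeta> in lborel. \<zeta> \<in> {0..1} \<longrightarrow>
        ?R \<zeta> = max_corr (biv_gev_cdf \<zeta> \<gamma>) \<and> max_corr (biv_gev_cdf \<zeta> \<gamma>) = 1 - \<zeta>)"
    proof (intro AE_cong)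
      fix \<zeta> :: real
      have "?I \<zeta> - ?J \<zeta> = 0 \<longleftrightarrow> (\<zeta> \<in> {0..1} \<longrightarrow> ?R \<zeta> = 1 - \<zeta>)"
      proof (cases "\<zeta> \<in> {0..1}")
        case True
        \<comment> \<open>The integrand of the gap is \<open>?V\<close> times the shortfall of the
          correlation from \<open>1 - \<zeta>\<close>; outside the unit interval both sides of the
          equivalence hold trivially.\<close>
        then have "?I \<zeta> - ?J \<zeta> = ?V * ((1 - \<zeta>) - ?R \<zeta>)"
          using V by (simp add: R[OF True] right_diff_distrib mult.commute)
        then show ?thesis using True V by auto
      qed auto
      \<comment> \<open>A correlation equal to \<open>1 - \<zeta>\<close> forces the supremum to be
        \<open>1 - \<zeta>\<close>; the converse is transitivity.\<close>
      then show "?I \<zeta> - ?J \<zeta> = 0 \<longleftrightarrow> (\<zeta> \<in> {0..1} \<longrightarrow>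
          ?R \<zeta> = max_corr (biv_gev_cdf \<zeta> \<gamma>) \<and> max_corr (biv_gev_cdf \<zeta> \<gamma>) = 1 - \<zeta>)"
        using max_corr_biv_gev_eqI[of \<zeta> \<gamma> h] h V by auto
    qed
    finally show ?thesis .
  qed
  ultimately show ?thesis by blast
qed

end
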